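(* Let $\mathfrak{A}$ be a real normed division algebra, i.e. $\mathfrak{A}=\mathbb{R},\mathbb{C},\mathbb{H}$ or $\mathbb{O}$, of real dimension $\beta=1,2,4$ or $8$ respectively, and let $n\ge m\ge 1$ be integers. Let $\rho>0$, $k\in\mathbb{R}$ and $\nu$ with $\mathrm{Re}(\nu\beta/2)>k$, let $\tau=(t_1,\dots,t_m)\in\mathbb{R}^m$ with $\mathrm{Re}(n\beta/2)>(m-1)\beta/2+t_1$, let $\boldsymbol{\Sigma}\in\mathfrak{P}_m^{\beta}$, $\boldsymbol{\Theta}\in\mathfrak{P}_n^{\beta}$, and let $\boldsymbol{\mu}\in\mathfrak{L}_{n,m}^{\beta}$ be a constant matrix. Let $S=(S^{1/2})^2$ have the one-dimensional Riesz type II distribution $\mathcal{R}_1^{\beta,II}(\nu\beta/2,k,\rho)$, and let $\mathbf{Y}$ be a random $n\times m$ matrix over $\mathfrak{A}$, independent of $S$, with the Kotz-Riesz type II distribution $\mathcal{KR}^{\beta,II}_{n\times m}(\tau,\mathbf{0},\boldsymbol{\Theta},\boldsymbol{\Sigma})$. Define $\mathbf{T}=S^{-1/2}\mathbf{Y}+\boldsymbol{\mu}\in\mathfrak{L}_{n,m}^{\beta}$. Then the density of $\mathbf{T}$ with respect to Lebesgue measure $(d\mathbf{T})$ on $\mathfrak{A}^{n\times m}$ is $$ c\,\left[1+\rho\,\mathrm{tr}\,\boldsymbol{\Sigma}^{-1}(\mathbf{T}-\boldsymbol{\mu})^{*}\boldsymbol{\Theta}^{-1}(\mathbf{T}-\boldsymbol{\mu})\right]^{-\left[(\nu+mn)\beta/2-k-\sum_{i=1}^m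 t_i\right]}\; q_{\tau}\!\left[\left(\mathcal{U}(\boldsymbol{\Sigma})^{*-1}(\mathbf{T}-\boldsymbol{\mu})^{*}\boldsymbol{\Theta}^{-1}(\mathbf{T}-\boldsymbol{\mu})\,\mathcal{U}(\boldsymbol{\Sigma})^{-1}\right)^{-1}\right], $$ where $$ c=\frac{\Gamma_m^{\beta}[n\beta/2]\;\Gamma_1^{\beta}\!\left[(\nu+mn)\beta/2-k-\sum_{i=1}^m t_i\right]\;\rho^{\beta mn/2-\sum_{i=1}^m t_i}}{\pi^{\beta mn/2}\;\Gamma_m^{\beta}[n\beta/2,-\tau]\;\Gamma_1^{\beta}[\nu\beta/2-k]\;|\boldsymbol{\Sigma}|^{\beta n/2}\,|\boldsymbol{\Theta}|^{\beta m/2}}. $$ This law is termed the matrix multivariate $T$-Riesz type II distribution.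
   Context: Notation. $\mathfrak{A}$ is one of the four real normed division algebras: $\mathbb{R}$, $\mathbb{C}$, $\mathbb{H}$ (quaternions), $\mathbb{O}$ (octonions), of real dimension $\beta=1,2,4,8$. (The authors include the octonions, but remark that the veracity of the results in that case can in general only be conjectured, while asserting validity for the Albert algebra, i.e. when the Hermitian matrices are $3\times3$ octonionic.) $\mathfrak{A}^{n\times m}$ is the space of $n\times m$ matrices over $\mathfrak{A}$, identified with $\mathbb{R}^{\beta nm}$ by real components of the entries and given the corresponding Lebesgue measure. $\mathbf{A}^*$ is the conjugate transpose. $\mathfrak{L}^{\beta}_{n,m}$ is the set of $n\times m$ matrices over $\mathfrak{A}$ of rank $m\le n$ with $m$ distinct positive singular values. $\mathfrak{P}_m^{\beta}$ is the cone of positive definite Hermitian $m\times m$ matrices over $\mathfrak{A}$. $|\cdot|$ is the determinant of a Hermitian matrix (product of the eigenvalues). $\mathrm{tr}$ denotes the (real part of the) trace, and $\mathrm{etr}(\cdot)=\exp(\mathrm{tr}(\cdot))$. For $\mathbf{B}\in\mathfrak{P}_m^\beta$, $\mathcal{U}(\mathbf{B})$ is the upper triangular matrix with positive diagonal such that $\mathbf{B}=\mathcal{U}(\mathbf{B})^*\mathcal{U}(\mathbf{B})$ (Cholesky decomposition). Generalised power (highest weight vector). For $\kappa=(k_1,\dots,k_m)\in\mathbb{R}^m$, $q_\kappa(\mathbf{A})=|\mathbf{A}_m|^{k_m}\prod_{i=1}^{m-1}|\mathbf{A}_i|^{k_i-k_{i+1}}$, where $\mathbf{A}_p$ is the leading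 principal $p\times p$ submatrix of $\mathbf{A}$. Gamma functions. $\Gamma_m^\beta[a]=\pi^{m(m-1)\beta/4}\prod_{i=1}^m\Gamma[a-(i-1)\beta/2]$ and $\Gamma_m^\beta[a,-\kappa]=\pi^{m(m-1)\beta/4}\prod_{i=1}^m\Gamma[a-k_i-(m-i)\beta/2]$, where $\Gamma=\Gamma_1^\beta$ is the ordinary gamma function. Riesz type II distribution in dimension one. $S\sim\mathcal{R}_1^{\beta,II}(a,k,\rho)$ means that $S$ has density on $(0,\infty)$ $$\frac{\beta^{a-k}}{\Gamma[a-k]\,\rho^{a-k}}\,e^{-\beta s/\rho}\,s^{a-k-1}.$$ Kotz-Riesz type II distribution. $\mathbf{Y}\sim\mathcal{KR}^{\beta,II}_{n\times m}(\kappa,\boldsymbol{\mu},\boldsymbol{\Theta},\boldsymbol{\Sigma})$ means that $\mathbf{Y}$ has density with respect to Lebesgue measure on $\mathfrak{A}^{n\times m}$ $$\frac{\beta^{mn\beta/2-\sum_i k_i}\,\Gamma_m^\beta[n\beta/2]}{\pi^{mn\beta/2}\,\Gamma_m^\beta[n\beta/2,-\kappa]\,|\boldsymbol{\Sigma}|^{n\beta/2}|\boldsymbol{\Theta}|^{m\beta/2}}\,\mathrm{etr}\{-\beta\,\boldsymbol{\Sigma}^{-1}(\mathbf{Y}-\boldsymbol{\mu})^*\boldsymbol{\Theta}^{-1}(\mathbf{Y}-\boldsymbol{\mu})\}\; q_\kappa\!\left[\left(\mathcal{U}(\boldsymbol{\Sigma})^{*-1}(\mathbf{Y}-\boldsymbol{\mu})^*\boldsymbol{\Theta}^{-1}(\mathbf{Y}-\boldsymbol{\mu})\,\mathcal{U}(\boldsymbol{\Sigma})^{-1}\right)^{-1}\right],$$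 with $\mathrm{Re}(n\beta/2)>(m-1)\beta/2+k_1$. *)

theory Defs
  imports "HOL-Probability.Probability"
begin

section \<open>Real normed division algebras\<close>

text \<open>
  A real normed division algebra is a nonzero finite-dimensional real vector space with a bilinear,
  not necessarily associative, multiplication that has a unit, and with a multiplicative norm.
  By Hurwitz' theorem the members of this class are, up to isometric isomorphism, exactly the reals,
  the complex numbers, the quaternions and the octonions; all four are instantiated below.
  The library classes of rings cannot be used, as they are all associative.
  The orthonormal basis of class \<^class>\<open>euclidean_space\<close> supplies the real components, hence
  Lebesgue measure \<^const>\<open>lborel\<close>, and \<open>\<beta> = DIM('a)\<close>.
\<close>

class normed_division_algebra = euclidean_space + one + times +
  assumes nda_add_left: "(x + y) * z = x * z + y * z"
    and nda_add_right: "x * (y + z) = x * y + x * z"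
    and nda_scaleR_left: "(r *\<^sub>R x) * y = r *\<^sub>R (x * y)"
    and nda_scaleR_right: "x * (r *\<^sub>R y) = r *\<^sub>R (x * y)"
    and nda_one_left: "1 * x = x"
    and nda_one_right: "x * 1 = x"
    and nda_norm_mult: "norm (x * y) = norm x * norm y"

class assoc_normed_division_algebra = normed_division_algebra +
  assumes nda_assoc: "(x * y) * z = x * (y * z)"

class comm_normed_division_algebra = assoc_normed_division_algebra +
  assumes nda_commute: "x * y = y * x"

text \<open>Conjugation fixes the real line \<open>\<real> 1\<close> and negates its orthogonal complement.\<close>

definition nconj :: "'a::normed_division_algebra \<Rightarrow> 'a" where
  "nconj x = (2 * inner x 1) *\<^sub>R 1 - x"

instance real :: comm_normed_division_algebra
  by standard (auto simp: algebra_simps abs_mult)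

instance complex :: comm_normed_division_algebra
  by standard (auto simp: algebra_simps norm_mult)

lemma nconj_real: "nconj (x::real) = x"
  by (simp add: nconj_def)

lemma nconj_complex: "nconj (z::complex) = cnj z"
  by (simp add: nconj_def complex_eq_iff inner_complex_def)

lemma norm_one_nda: "norm (1::'a::normed_division_algebra) = 1"
proof -
  obtain b :: 'a where "b \<in> Basis" using nonempty_Basis by blast
  then have "norm b = 1" by simp
  then show ?thesis using nda_norm_mult[of 1 b] by (simp add: nda_one_left)
qed

lemma inner_one_nda [simp]: "inner (1::'a::normed_division_algebra) 1 = 1"
  using norm_one_nda[where 'a='a] by (simp add: norm_eq_1)

lemma nda_minus_left: "(- x) * y = - (x * (y::'a::normed_division_algebra))"
  using nda_scaleR_left[of "-1" x y] by simp

lemma nda_minus_right: "x * (- y) = - (x * (y::'a::normed_division_algebra))"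
  using nda_scaleR_right[of x "-1" y] by simp

lemma nda_zero_left [simp]: "0 * (y::'a::normed_division_algebra) = 0"
  using nda_scaleR_left[of 0 0 y] by simp

lemma nda_zero_right [simp]: "(x::'a::normed_division_algebra) * 0 = 0"
  using nda_scaleR_right[of x 0 0] by simp

lemma nda_diff_left: "(x - y) * z = x * z - y * (z::'a::normed_division_algebra)"
  using nda_add_left[of x "- y" z] by (simp add: nda_minus_left)

lemma nda_diff_right: "x * (y - z) = x * y - x * (z::'a::normed_division_algebra)"
  using nda_add_right[of x y "- z"] by (simp add: nda_minus_right)

lemma nconj_conj [simp]: "nconj (nconj x) = (x::'a::normed_division_algebra)"
  by (simp add: nconj_def inner_diff_left algebra_simps)

lemma nconj_add: "nconj (x + y) = nconj x + nconj (y::'a::normed_division_algebra)"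
  by (simp add: nconj_def inner_add_left algebra_simps scaleR_left_distrib)

lemma nconj_scaleR: "nconj (r *\<^sub>R x) = r *\<^sub>R nconj (x::'a::normed_division_algebra)"
  by (simp add: nconj_def algebra_simps)

lemma norm_nconj: "norm (nconj x) = norm (x::'a::normed_division_algebra)"
proof -
  have "inner (nconj x) (nconj x) = inner x x"
    by (simp add: nconj_def inner_diff_left inner_diff_right inner_commute algebra_simps)
  then show ?thesis by (simp add: norm_eq_sqrt_inner)
qed

lemma nda_inner_mult_left:
  fixes x y a b :: "'a::normed_division_algebra"
  shows "inner (x * a) (x * b) = inner x x * inner a b"
proof -
  have n: "inner (u * v) (u * v) = inner u u * inner v v" for u v :: 'a
    using nda_norm_mult[of u v] by (simp add: dot_square_norm power_mult_distrib)
  show ?thesis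
    using n[of x "a + b"] n[of x a] n[of x b]
    by (simp add: nda_add_right inner_add_left inner_add_right inner_commute algebra_simps)
qed

lemma nda_inner_mult_right:
  fixes x y a b :: "'a::normed_division_algebra"
  shows "inner (a * x) (b * x) = inner a b * inner x x"
proof -
  have n: "inner (u * v) (u * v) = inner u u * inner v v" for u v :: 'a
    using nda_norm_mult[of u v] by (simp add: dot_square_norm power_mult_distrib)
  show ?thesis
    using n[of "a + b" x] n[of a x] n[of b x]
    by (simp add: nda_add_left inner_add_left inner_add_right inner_commute algebra_simps)
qed

lemma nda_inner_adjoint_left:
  fixes x a b :: "'a::normed_division_algebra"
  shows "inner (x * a) b = inner a (nconj x * b)"
  using nda_inner_mult_left[of "x + 1" a b] nda_inner_mult_left[of x a b]
    nda_inner_mult_left[of 1 a b]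
  by (simp add: nconj_def nda_add_left nda_diff_left nda_scaleR_left nda_one_left inner_add_left
      inner_add_right inner_diff_right inner_commute algebra_simps)

lemma nda_inner_adjoint_right:
  fixes x a b :: "'a::normed_division_algebra"
  shows "inner (a * x) b = inner a (b * nconj x)"
  using nda_inner_mult_right[of a "x + 1" b] nda_inner_mult_right[of a x b]
    nda_inner_mult_right[of a 1 b]
  by (simp add: nconj_def nda_add_right nda_diff_right nda_scaleR_right nda_one_right inner_add_left
      inner_add_right inner_diff_right inner_commute algebra_simps)

lemma inner_nconj_left: "inner (nconj x) y = inner x (nconj (y::'a::normed_division_algebra))"
  by (simp add: nconj_def inner_diff_left inner_diff_right inner_commute)

lemma nconj_mult: "nconj (x * y) = nconj y * nconj (x::'a::normed_division_algebra)"
proof -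
  have "inner (nconj (x * y)) z = inner (nconj y * nconj x) z" for z
  proof -
    have "inner (nconj (x * y)) z = inner (x * y) (nconj z)" by (rule inner_nconj_left)
    also have "\<dots> = inner y (nconj x * nconj z)" by (rule nda_inner_adjoint_left)
    also have "\<dots> = inner (y * z) (nconj x)"
      by (simp add: nda_inner_adjoint_right)
    also have "\<dots> = inner z (nconj y * nconj x)" by (rule nda_inner_adjoint_left)
    finally show ?thesis by (simp add: inner_commute)
  qed
  then show ?thesis by (metis vector_eq_rdot)
qed


subsection \<open>Quaternions and octonions\<close>

text \<open>The Cayley-Dickson double of an algebra.\<close>

datatype 'a cd = CD (cd1: 'a) (cd2: 'a)

lemma cd_eq_iff: "x = y \<longleftrightarrow> cd1 x = cd1 y \<and> cd2 x = cd2 y"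
  by (cases x; cases y) auto

instantiation cd :: (real_vector) real_vector
begin
definition "0 = CD 0 0"
definition "x + y = CD (cd1 x + cd1 y) (cd2 x + cd2 y)"
definition "- x = CD (- cd1 x) (- cd2 x)"
definition "x - y = CD (cd1 x - cd1 y) (cd2 x - cd2 y)"
definition "r *\<^sub>R x = CD (r *\<^sub>R cd1 x) (r *\<^sub>R cd2 x)"
instance
  by standard
    (simp_all add: cd_eq_iff zero_cd_def plus_cd_def uminus_cd_def minus_cd_def scaleR_cd_def
      scaleR_left_distrib scaleR_right_distrib)
end

instantiation cd :: (real_inner) real_inner
begin
definition "inner x y = inner (cd1 x) (cd1 y) + inner (cd2 x) (cd2 y)"
definition norm_cd where "norm_cd (x::'a cd) = sqrt (inner x x)"
definition sgn_cd where "sgn_cd (x::'a cd) = x /\<^sub>R norm x"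
definition dist_cd where "dist_cd (x::'a cd) y = norm (x - y)"
definition uniformity_cd :: "('a cd \<times> 'a cd) filter"
  where "uniformity_cd = (INF e\<in>{0<..}. principal {(x, y). dist x y < e})"
definition open_cd :: "'a cd set \<Rightarrow> bool"
  where "open_cd U \<longleftrightarrow> (\<forall>x\<in>U. eventually (\<lambda>(x', y). x' = x \<longrightarrow> y \<in> U) uniformity)"
instance
  by standard
    (auto simp: sgn_cd_def dist_cd_def uniformity_cd_def open_cd_def norm_cd_def inner_cd_def
      cd_eq_iff zero_cd_def plus_cd_def scaleR_cd_def inner_add_left inner_add_right inner_commute
      distrib_left add_nonneg_eq_0_iff)
end

instantiation cd :: (euclidean_space) euclidean_space
begin
definition "Basis = (\<lambda>b. CD b 0) ` Basis \<union> (\<lambda>b. CD 0 b) ` Basis"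
instance
proof
  show "(Basis :: 'a cd set) \<noteq> {}" by (simp add: Basis_cd_def)
  show "finite (Basis :: 'a cd set)" by (simp add: Basis_cd_def)
  show "inner u v = (if u = v then 1 else 0)"
    if "u \<in> Basis" "v \<in> Basis" for u v :: "'a cd"
    using that by (auto simp: Basis_cd_def inner_cd_def inner_Basis split: if_splits)
  show "(\<forall>u\<in>Basis. inner x u = 0) \<longleftrightarrow> x = 0" for x :: "'a cd"
    by (auto simp: Basis_cd_def inner_cd_def ball_Un cd_eq_iff zero_cd_def euclidean_all_zero_iff)
qed
end

lemma DIM_cd: "DIM('a::euclidean_space cd) = 2 * DIM('a)"
proof -
  have "DIM('a cd) = card ((\<lambda>b::'a. CD b 0) ` Basis) + card ((\<lambda>b::'a. CD 0 b) ` Basis)"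
    unfolding Basis_cd_def by (rule card_Un_disjoint) auto
  also have "\<dots> = DIM('a) + DIM('a)"
    by (simp add: card_image inj_on_def)
  finally show ?thesis by simp
qed

instantiation cd :: (assoc_normed_division_algebra) normed_division_algebra
begin
definition "1 = CD 1 0"
definition "x * y = CD (cd1 x * cd1 y - nconj (cd2 y) * cd2 x) (cd2 y * cd1 x + cd2 x * nconj (cd1 y))"
instance
proof
  fix x y z :: "'a cd" and r :: real
  note defs = cd_eq_iff plus_cd_def scaleR_cd_def times_cd_def one_cd_def
  show "(x + y) * z = x * z + y * z"
    by (simp add: defs nda_add_left nda_add_right)
  show "x * (y + z) = x * y + x * z"
    by (simp add: defs nda_add_left nda_add_right nconj_add)
  show "(r *\<^sub>R x) * y = r *\<^sub>R (x * y)"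
    by (simp add: defs nda_scaleR_left nda_scaleR_right algebra_simps)
  show "x * (r *\<^sub>R y) = r *\<^sub>R (x * y)"
    by (simp add: defs nda_scaleR_left nda_scaleR_right nconj_scaleR algebra_simps)
  have [simp]: "nconj 0 = (0::'a)" "nconj 1 = (1::'a)"
    by (simp_all add: nconj_def scaleR_2)
  show "1 * x = x" "x * 1 = x"
    by (simp_all add: defs nda_one_left nda_one_right)
  show "norm (x * y) = norm x * norm y"
  proof -
    obtain a b c d where xy: "x = CD a b" "y = CD c d" by (metis cd.exhaust)
    have n: "inner (u * v) (u * v) = inner u u * inner v v" for u v :: 'a
      using nda_norm_mult[of u v] by (simp add: dot_square_norm power_mult_distrib)
    have c: "inner (nconj u) (nconj u) = inner u u" for u :: 'a
      using norm_nconj[of u] by (simp add: dot_square_norm)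
    have "inner (a * c) (nconj d * b) = inner (d * (a * c)) b"
      by (simp add: nda_inner_adjoint_left)
    also have "\<dots> = inner (d * a) (b * nconj c)"
      by (simp add: nda_inner_adjoint_right flip: nda_assoc)
    finally have "inner (x * y) (x * y) = inner x x * inner y y"
      by (simp add: xy times_cd_def inner_cd_def inner_diff_left inner_diff_right inner_add_left
          inner_add_right n c inner_commute algebra_simps)
    then show ?thesis by (simp add: norm_cd_def real_sqrt_mult)
  qed
qed
end

instance cd :: (comm_normed_division_algebra) assoc_normed_division_algebra
proof
  have rot: "(u * v) * w = (u * w) * v" "u * (v * w) = v * (u * w)" for u v w :: 'a
    by (metis nda_assoc nda_commute)+
  fix x y z :: "'a cd"
  have c: "nconj (u - v) = nconj u - nconj v" for u v :: 'a
    using nconj_add[of u "-v"] nconj_scaleR[of "-1" v] by simp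
  show "(x * y) * z = x * (y * z)"
    by (simp add: cd_eq_iff times_cd_def nda_add_left nda_add_right nda_diff_left nda_diff_right
        nconj_add c nconj_mult nda_assoc rot(2) nda_commute algebra_simps)
qed

type_synonym quaternion = "complex cd"
type_synonym octonion = "quaternion cd"

lemma DIM_division_algebras:
  "DIM(real) = 1" "DIM(complex) = 2" "DIM(quaternion) = 4" "DIM(octonion) = 8"
  by (simp_all add: DIM_cd)


section \<open>Matrices over a real normed division algebra\<close>

text \<open>
  An \<open>n \<times> m\<close> matrix has type \<^typ>\<open>'a^'m^'n\<close>. The order of the column index type numbers its elements
  \<open>1, \<dots>, m\<close>; it is needed for leading submatrices and triangular matrices.
  The library product \<^const>\<open>matrix_matrix_mult\<close> is confined to associative entries.
\<close>

type_synonym ('a, 'n, 'm) mtx = "(('a, 'm) vec, 'n) vec"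

definition mmul :: "'a::normed_division_algebra^'m^'n \<Rightarrow> 'a^'l^'m \<Rightarrow> 'a^'l^'n" (infixl "\<star>" 70)
  where "A \<star> B = (\<chi> i j. \<Sum>k\<in>UNIV. A $ i $ k * B $ k $ j)"

definition mvec :: "'a::normed_division_algebra^'m^'n \<Rightarrow> 'a^'m \<Rightarrow> 'a^'n" (infixl "\<star>v" 70)
  where "A \<star>v x = (\<chi> i. \<Sum>k\<in>UNIV. A $ i $ k * x $ k)"

definition ctrans :: "'a::normed_division_algebra^'m^'n \<Rightarrow> 'a^'n^'m"
  where "ctrans A = (\<chi> i j. nconj (A $ j $ i))"

definition hermitian :: "'a::normed_division_algebra^'m^'m \<Rightarrow> bool"
  where "hermitian A \<longleftrightarrow> ctrans A = A"

definition jprod :: "'a::normed_division_algebra^'m^'m \<Rightarrow> 'a^'m^'m \<Rightarrow> 'a^'m^'m" (infixl "\<circ>J" 70)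
  where "A \<circ>J B = (1/2) *\<^sub>R (A \<star> B + B \<star> A)"

text \<open>
  The product \<open>A B C\<close>: the mean of its two bracketings. They coincide over the reals, the complex
  numbers and the quaternions (lemma \<open>mmul3_assoc\<close>). Over the octonions neither bracketing of
  \<open>X\<^sup>* A X\<close> with \<open>A\<close> Hermitian need be Hermitian, but they are each other's conjugate transposes, so that
  the mean is.
\<close>

definition mmul3 :: "'a::normed_division_algebra^'m^'n \<Rightarrow> 'a^'l^'m \<Rightarrow> 'a^'p^'l \<Rightarrow> 'a^'p^'n"
  where "mmul3 A B C = (1/2) *\<^sub>R ((A \<star> B) \<star> C + A \<star> (B \<star> C))"

text \<open>
  The inverse, in the sense of Jordan algebras. Over the reals, the complex numbers and the quaternions
  it is the usual two-sided inverse (lemma \<open>is_inverse_assoc\<close>). A Hermitian octonionic matrix has in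
  general no two-sided inverse for the matrix product even if its determinant is nonzero, while its
  inverse in the Albert algebra is the one below. The value at noninvertible matrices is immaterial.
\<close>

definition is_inverse :: "'a::normed_division_algebra^'m^'m \<Rightarrow> 'a^'m^'m \<Rightarrow> bool"
  where "is_inverse A B \<longleftrightarrow> A \<circ>J B = mat 1 \<and> (A \<circ>J A) \<circ>J B = A \<and>
    (hermitian A \<longrightarrow> hermitian B)"

definition minv :: "'a::normed_division_algebra^'m^'m \<Rightarrow> 'a^'m^'m"
  where "minv A = (if \<exists>!B. is_inverse A B then THE B. is_inverse A B else 0)"

definition re_trace :: "'a::normed_division_algebra^'m^'m \<Rightarrow> real"
  where "re_trace A = inner (\<Sum>i\<in>UNIV. A $ i $ i) 1"

definition etr :: "'a::normed_division_algebra^'m^'m \<Rightarrow> real"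
  where "etr A = exp (re_trace A)"


subsection \<open>Eigenvalues, determinant and positive definiteness of Hermitian matrices\<close>

text \<open>The principal submatrix with rows and columns in \<open>I\<close>, padded with zeros.\<close>

definition psub :: "'m set \<Rightarrow> 'a::normed_division_algebra^'m^'m \<Rightarrow> 'a^'m^'m"
  where "psub I A = (\<chi> i j. if i \<in> I \<and> j \<in> I then A $ i $ j else 0)"

text \<open>
  \<open>eigenvalues_on I A \<alpha>\<close>: the eigenvalues, with multiplicities, of the Hermitian submatrix \<open>psub I A\<close>
  (as a matrix of size \<^term>\<open>card I\<close>) are \<open>\<alpha> i\<close> for \<open>i \<in> I\<close>. This is read off a spectral decomposition
  \<open>\<Sum>i. \<alpha> i E i\<close>, where \<open>E\<close> is a Jordan frame, i.e. a complete system of as many orthogonal idempotents as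
  the matrix has rows. Over the reals, the complex numbers and the quaternions the \<open>E i\<close> are the orthogonal
  projections onto the lines spanned by an orthonormal basis of eigenvectors, and the \<open>\<alpha> i\<close> are the numbers
  \<open>r\<close> with \<open>A v = r v\<close> for some \<open>v \<noteq> 0\<close> (lemma \<open>eigenvalues_eigenvectors\<close>). Over the octonions that
  equation is not adequate, because a Hermitian \<open>3 \<times> 3\<close> matrix has in general six such \<open>r\<close>;
  the \<open>\<alpha> i\<close> are then the eigenvalues in the sense of the Albert algebra.
\<close>

definition eigenvalues_on ::
    "'m set \<Rightarrow> 'a::normed_division_algebra^'m^'m \<Rightarrow> ('m \<Rightarrow> real) \<Rightarrow> bool"
  where "eigenvalues_on I A \<alpha> \<longleftrightarrow>
    (\<exists>E :: 'm \<Rightarrow> 'a^'m^'m.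
      (\<forall>i\<in>I. hermitian (E i) \<and> E i \<noteq> 0 \<and> E i \<circ>J E i = E i) \<and>
      (\<forall>i\<in>I. \<forall>j\<in>I. i \<noteq> j \<longrightarrow> E i \<circ>J E j = 0) \<and>
      (\<Sum>i\<in>I. E i) = psub I (mat 1) \<and>
      psub I A = (\<Sum>i\<in>I. \<alpha> i *\<^sub>R E i))"

text \<open>
  The determinant of the principal submatrix: the product of the eigenvalues. The value \<open>0\<close> is
  a dummy for matrices that are not Hermitian, and for octonionic matrices of size \<open>> 3\<close> (which
  form no Jordan algebra) that have no, or no unambiguous, product of eigenvalues.
\<close>

definition det_on :: "'m set \<Rightarrow> 'a::normed_division_algebra^'m^'m \<Rightarrow> real"
  where "det_on I A =
    (if \<exists>!d. \<exists>\<alpha>. eigenvalues_on I A \<alpha> \<and> d = (\<Prod>i\<in>I. \<alpha> i)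
     then THE d. \<exists>\<alpha>. eigenvalues_on I A \<alpha> \<and> d = (\<Prod>i\<in>I. \<alpha> i) else 0)"

abbreviation hdet :: "'a::normed_division_algebra^'m^'m \<Rightarrow> real"
  where "hdet A \<equiv> det_on UNIV A"

text \<open>Positive definite: Hermitian with positive eigenvalues.\<close>

definition pos_def_cone :: "('a::normed_division_algebra^'m^'m) set"
  where "pos_def_cone =
    {A. hermitian A \<and> (\<exists>\<alpha>. eigenvalues_on UNIV A \<alpha> \<and> (\<forall>i. \<alpha> i > 0))}"

text \<open>
  Matrices of rank \<open>m\<close> (linearly independent columns) with \<open>m\<close> distinct positive singular values,
  the singular values of \<open>X\<close> being the square roots of the eigenvalues of \<open>X\<^sup>* X\<close>.
\<close>

definition distinct_sv_matrices :: "('a::normed_division_algebra^'m^'n) set"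
  where "distinct_sv_matrices =
    {X. (\<forall>v. X \<star>v v = 0 \<longrightarrow> v = 0) \<and>
        (\<exists>\<sigma>. inj \<sigma> \<and> (\<forall>i. \<sigma> i > 0) \<and> eigenvalues_on UNIV (ctrans X \<star> X) (\<lambda>i. (\<sigma> i)\<^sup>2))}"

definition cholesky :: "('a::normed_division_algebra, 'm::{finite,linorder}, 'm) mtx \<Rightarrow> ('a, 'm, 'm) mtx"
  where "cholesky B = (THE U. (\<forall>i j. j < i \<longrightarrow> U $ i $ j = 0) \<and>
    (\<forall>i. \<exists>r>0. U $ i $ i = r *\<^sub>R 1) \<and> B = ctrans U \<star> U)"

text \<open>The first \<open>p\<close> indices, and the generalised power; \<open>\<kappa> = (\<kappa> 1, \<dots>, \<kappa> m)\<close>.\<close>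

definition leading :: "nat \<Rightarrow> ('m::{finite,linorder}) set"
  where "leading p = {i. card {j. j \<le> i} \<le> p}"

definition gen_power :: "(nat \<Rightarrow> real) \<Rightarrow> ('a::normed_division_algebra, 'm::{finite,linorder}, 'm) mtx \<Rightarrow> real"
  where "gen_power \<kappa> A =
    det_on (leading CARD('m)) A powr \<kappa> CARD('m) *
    (\<Prod>i = 1..<CARD('m). det_on (leading i) A powr (\<kappa> i - \<kappa> (i + 1)))"


subsection \<open>The associative case\<close>

lemma mmul_assoc:
  fixes A :: "'a::assoc_normed_division_algebra^'m^'n"
  shows "(A \<star> B) \<star> C = A \<star> (B \<star> C)"
proof -
  have l: "(\<Sum>k\<in>K. f k) * x = (\<Sum>k\<in>K. f k * x)" for f :: "'k \<Rightarrow> 'a" and x K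
    by (induction K rule: infinite_finite_induct) (auto simp: nda_add_left)
  have r: "x * (\<Sum>k\<in>K. f k) = (\<Sum>k\<in>K. x * f k)" for f :: "'k \<Rightarrow> 'a" and x K
    by (induction K rule: infinite_finite_induct) (auto simp: nda_add_right)
  show ?thesis
    unfolding mmul_def vec_eq_iff
    by (auto simp: l r nda_assoc intro: sum.swap)
qed

lemma mmul3_assoc:
  fixes A :: "'a::assoc_normed_division_algebra^'m^'n"
  shows "mmul3 A B C = (A \<star> B) \<star> C"
  by (simp add: mmul3_def mmul_assoc flip: scaleR_2)

lemma mmul_add_left: "(A + B) \<star> C = A \<star> C + B \<star> C"
  by (simp add: mmul_def vec_eq_iff nda_add_left sum.distrib)

lemma mmul_add_right: "A \<star> (B + C) = A \<star> B + A \<star> C"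
  by (simp add: mmul_def vec_eq_iff nda_add_right sum.distrib)

lemma mmul_scaleR_left: "(r *\<^sub>R A) \<star> B = r *\<^sub>R (A \<star> B)"
  by (simp add: mmul_def vec_eq_iff nda_scaleR_left scaleR_sum_right)

lemma mmul_scaleR_right: "A \<star> (r *\<^sub>R B) = r *\<^sub>R (A \<star> B)"
  by (simp add: mmul_def vec_eq_iff nda_scaleR_right scaleR_sum_right)

lemma mmul_zero [simp]: "A \<star> 0 = 0" "0 \<star> A = 0"
  by (simp_all add: mmul_def vec_eq_iff)

lemma mmul_one [simp]: "A \<star> mat 1 = A" "mat 1 \<star> A = A"
proof -
  have "x * (if P then 1 else 0) = (if P then x else 0)"
       "(if P then 1 else 0) * x = (if P then x else 0)" for P and x :: 'a
    by (auto simp: nda_one_left nda_one_right)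
  then show "A \<star> mat 1 = A" "mat 1 \<star> A = A"
    by (simp_all add: mmul_def mat_def vec_eq_iff)
qed

lemma ctrans_mmul: "ctrans (A \<star> B) = ctrans B \<star> ctrans A"
proof -
  have c: "nconj (\<Sum>k\<in>K. f k) = (\<Sum>k\<in>K. nconj (f k))" for f :: "'k \<Rightarrow> 'a" and K
    by (induction K rule: infinite_finite_induct) (auto simp: nconj_add, simp_all add: nconj_def)
  show ?thesis by (simp add: ctrans_def mmul_def vec_eq_iff c nconj_mult)
qed

lemma ctrans_one: "ctrans (mat 1) = mat 1"
  by (auto simp: ctrans_def mat_def vec_eq_iff nconj_def scaleR_2)

lemma is_inverse_assoc:
  fixes A :: "'a::assoc_normed_division_algebra^'m^'m"
  shows "is_inverse A B \<longleftrightarrow> A \<star> B = mat 1 \<and> B \<star> A = mat 1"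
proof
  assume "A \<star> B = mat 1 \<and> B \<star> A = mat 1"
  then have 1: "A \<star> B = mat 1" "B \<star> A = mat 1" by auto
  have 2: "(A \<star> A) \<star> B = A" using 1 by (simp add: mmul_assoc)
  have 3: "B \<star> (A \<star> A) = A" using 1 by (simp flip: mmul_assoc)
  have 4: "hermitian B" if "hermitian A"
  proof -
    have A: "ctrans A = A" using that by (simp add: hermitian_def)
    have "A \<star> ctrans B = mat 1" using arg_cong[OF 1(2), of ctrans] by (simp add: ctrans_mmul ctrans_one A)
    then have "(B \<star> A) \<star> ctrans B = B" by (simp add: mmul_assoc)
    then show ?thesis using 1 by (simp add: hermitian_def)
  qed
  show "is_inverse A B"
    by (simp add: is_inverse_def 4 jprod_def mmul_scaleR_left mmul_scaleR_right mmul_add_left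
        mmul_add_right 1 2 3 flip: scaleR_2)
next
  assume "is_inverse A B"
  then have h: "(1/2) *\<^sub>R (A \<star> B + B \<star> A) = mat 1" "(1/2) *\<^sub>R (A \<star> A \<star> B + B \<star> (A \<star> A)) = A"
    by (simp_all add: is_inverse_def jprod_def mmul_scaleR_left mmul_scaleR_right flip: scaleR_2)
  have half: "Z = 2 *\<^sub>R W" if "(1/2) *\<^sub>R Z = W" for Z W :: "'a^'m^'m" using that by auto
  note j = half[OF h(1)] half[OF h(2)]
  have e1: "A \<star> A \<star> B + A \<star> B \<star> A = 2 *\<^sub>R A"
    using arg_cong[OF j(1), of "\<lambda>X. A \<star> X"] by (simp add: mmul_add_right mmul_scaleR_right mmul_assoc)
  have e2: "A \<star> B \<star> A + B \<star> A \<star> A = 2 *\<^sub>R A"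
    using arg_cong[OF j(1), of "\<lambda>X. X \<star> A"] by (simp add: mmul_add_left mmul_scaleR_left)
  have "A \<star> A \<star> B = B \<star> A \<star> A" using e1 e2 by (metis add.commute add_left_cancel)
  then have "2 *\<^sub>R (A \<star> A \<star> B) = 2 *\<^sub>R A" "A \<star> A \<star> B = B \<star> A \<star> A"
    using j(2) by (simp_all add: scaleR_2 mmul_assoc)
  then have f: "A \<star> A \<star> B = A" "B \<star> A \<star> A = A" by auto
  have "B \<star> (A \<star> A \<star> B) = (B \<star> A \<star> A) \<star> B" by (simp add: mmul_assoc)
  then have "B \<star> A = A \<star> B" using f by simp
  then show "A \<star> B = mat 1 \<and> B \<star> A = mat 1"
    using j(1) by (simp flip: scaleR_2)
qed

lemma eigenvalues_eigenvectors:
  fixes A :: "'a::assoc_normed_division_algebra^'m^'m"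
  assumes "eigenvalues_on UNIV A \<alpha>"
  shows "(\<exists>v. v \<noteq> 0 \<and> A \<star>v v = r *\<^sub>R v) \<longleftrightarrow> (\<exists>i. r = \<alpha> i)"
proof -
  have conv: "B \<star>v v = w \<longleftrightarrow> B \<star> (\<chi> i j. v $ i) = (\<chi> i (j::'m). w $ i)" for B :: "'a^'m^'m" and v w
    by (simp add: mmul_def mvec_def vec_eq_iff)
  have [simp]: "psub UNIV B = B" for B :: "'a^'m^'m"
    by (simp add: psub_def vec_eq_iff)
  obtain E :: "'m \<Rightarrow> 'a^'m^'m" where E: "\<And>i. E i \<noteq> 0" "\<And>i. E i \<circ>J E i = E i"
      "\<And>i j. i \<noteq> j \<Longrightarrow> E i \<circ>J E j = 0" "(\<Sum>i\<in>UNIV. E i) = mat 1" "A = (\<Sum>i\<in>UNIV. \<alpha> i *\<^sub>R E i)"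
    using assms unfolding eigenvalues_on_def by auto
  have idem: "E i \<star> E i = E i" for i
    using E(2)[of i] by (simp add: jprod_def flip: scaleR_2)
  have orth: "E i \<star> E j = 0" if "i \<noteq> j" for i j
  proof -
    have s: "E i \<star> E j + E j \<star> E i = 0" using E(3)[OF that] by (simp add: jprod_def)
    have a: "E i \<star> E j + E i \<star> E j \<star> E i = 0"
      using arg_cong[OF s, of "\<lambda>X. E i \<star> X"] idem[of i]
      by (simp add: mmul_add_right flip: mmul_assoc)
    have b: "E i \<star> E j \<star> E i + E j \<star> E i = 0"
      using arg_cong[OF s, of "\<lambda>X. X \<star> E i"] idem[of i]
      by (simp add: mmul_add_left mmul_assoc)
    have "E i \<star> E j = E j \<star> E i" using a b by (metis add.commute add_left_cancel)
    then have "2 *\<^sub>R (E i \<star> E j) = 0" using s by (simp add: scaleR_2)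
    then show ?thesis by simp
  qed
  have sumr: "X \<star> (\<Sum>i\<in>K. F i) = (\<Sum>i\<in>K. X \<star> F i)" for X :: "'a^'m^'m" and F :: "'m \<Rightarrow> 'a^'m^'m" and K
    by (induction K rule: infinite_finite_induct) (auto simp: mmul_add_right)
  have suml: "(\<Sum>i\<in>K. F i) \<star> X = (\<Sum>i\<in>K. F i \<star> X)" for X :: "'a^'m^'m" and F :: "'m \<Rightarrow> 'a^'m^'m" and K
    by (induction K rule: infinite_finite_induct) (auto simp: mmul_add_left)
  have EE: "E i \<star> E j = (if j = i then E i else 0)" for i j using idem orth by auto
  have AE: "A \<star> E i = \<alpha> i *\<^sub>R E i" for i
    unfolding E(5) by (simp add: suml mmul_scaleR_left EE if_distrib cong: if_cong)
  have EA: "E i \<star> A = \<alpha> i *\<^sub>R E i" for i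
    unfolding E(5) by (simp add: sumr mmul_scaleR_right EE if_distrib cong: if_cong)
  show ?thesis
  proof
    assume "\<exists>i. r = \<alpha> i"
    then obtain i where i: "r = \<alpha> i" by blast
    obtain j where j: "(\<chi> k. E i $ k $ j) \<noteq> 0"
      using E(1)[of i] by (auto simp: vec_eq_iff)
    have "A \<star>v (\<chi> k. E i $ k $ j) = r *\<^sub>R (\<chi> k. E i $ k $ j)"
      using AE[of i] by (simp add: i mmul_def mvec_def vec_eq_iff)
    then show "\<exists>v. v \<noteq> 0 \<and> A \<star>v v = r *\<^sub>R v" using j by blast
  next
    assume "\<exists>v. v \<noteq> 0 \<and> A \<star>v v = r *\<^sub>R v"
    then obtain v where v: "v \<noteq> 0" "A \<star>v v = r *\<^sub>R v" by blast
    define V :: "'a^'m^'m" where "V = (\<chi> i j. v $ i)"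
    have V: "V \<noteq> 0" "A \<star> V = r *\<^sub>R V"
      using v conv[of A v "r *\<^sub>R v"] by (auto simp: V_def vec_eq_iff)
    show "\<exists>i. r = \<alpha> i"
    proof (rule ccontr)
      assume n: "\<nexists>i. r = \<alpha> i"
      have "E i \<star> V = 0" for i
      proof -
        have "E i \<star> (A \<star> V) = (E i \<star> A) \<star> V" by (simp add: mmul_assoc)
        then have "r *\<^sub>R (E i \<star> V) = \<alpha> i *\<^sub>R (E i \<star> V)"
          using V(2) EA[of i] by (simp add: mmul_scaleR_right mmul_scaleR_left)
        then show ?thesis using n by (auto simp: scaleR_right_imp_eq)
      qed
      then have "mat 1 \<star> V = 0" by (simp add: suml flip: E(4))
      then show False using V(1) by simp
    qed
  qed
qed


section \<open>Gamma functions and distributions\<close>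

text \<open>\<open>\<Gamma>\<^sub>m\<^sup>\<beta>[a]\<close> and \<open>\<Gamma>\<^sub>m\<^sup>\<beta>[a, -\<kappa>]\<close>.\<close>

definition mv_Gamma :: "real \<Rightarrow> nat \<Rightarrow> 'b::Gamma \<Rightarrow> 'b"
  where "mv_Gamma \<beta> m a =
    of_real (pi powr (real m * (real m - 1) * \<beta> / 4)) *
    (\<Prod>i = 1..m. Gamma (a - of_real ((real i - 1) * \<beta> / 2)))"

definition mv_Gamma_neg :: "real \<Rightarrow> nat \<Rightarrow> real \<Rightarrow> (nat \<Rightarrow> real) \<Rightarrow> real"
  where "mv_Gamma_neg \<beta> m a \<kappa> =
    pi powr (real m * (real m - 1) * \<beta> / 4) *
    (\<Prod>i = 1..m. Gamma (a - \<kappa> i - (real m - real i) * \<beta> / 2))"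

text \<open>
  \<open>X\<close> has density \<open>f\<close> with respect to Lebesgue measure. The formulas for densities below may contain
  a complex parameter; for a density, the value must be real and nonnegative.
\<close>

definition has_density :: "'w measure \<Rightarrow> ('w \<Rightarrow> 'b::euclidean_space) \<Rightarrow> ('b \<Rightarrow> complex) \<Rightarrow> bool"
  where "has_density M X f \<longleftrightarrow>
    (AE x in lborel. f x \<in> \<real>\<^sub>\<ge>\<^sub>0) \<and> distributed M lborel X (\<lambda>x. ennreal (Re (f x)))"

text \<open>\<^const>\<open>prob_space.indep_var\<close>, but for two random variables of different types.\<close>

definition indep_rvs ::
    "'w measure \<Rightarrow> ('w \<Rightarrow> 'b::euclidean_space) \<Rightarrow> ('w \<Rightarrow> 'c::euclidean_space) \<Rightarrow> bool"
  where "indep_rvs M X Y \<longleftrightarrow>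
    X \<in> borel_measurable M \<and> Y \<in> borel_measurable M \<and>
    prob_space.indep_set M {X -` A \<inter> space M | A. A \<in> sets borel} {Y -` B \<inter> space M | B. B \<in> sets borel}"

text \<open>The one-dimensional Riesz distribution of type II.\<close>

definition riesz_II :: "'w measure \<Rightarrow> ('w \<Rightarrow> real) \<Rightarrow> real \<Rightarrow> complex \<Rightarrow> real \<Rightarrow> real \<Rightarrow> bool"
  where "riesz_II M S \<beta> a k \<rho> \<longleftrightarrow>
    has_density M S (\<lambda>s. if s > 0 then
        of_real \<beta> powr (a - of_real k) / (Gamma (a - of_real k) * of_real \<rho> powr (a - of_real k)) *
        of_real (exp (- \<beta> * s / \<rho>)) * of_real s powr (a - of_real k - 1)
      else 0)"

text \<open>\<open>q\<^sub>\<kappa>[(U(\<Sigma>)\<^sup>*\<^sup>-\<^sup>1 X\<^sup>* \<Theta>\<^sup>-\<^sup>1 X U(\<Sigma>)\<^sup>-\<^sup>1)\<^sup>-\<^sup>1]\<close>\<close>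

definition q_factor ::
    "(nat \<Rightarrow> real) \<Rightarrow> ('a::normed_division_algebra, 'n::finite, 'n) mtx \<Rightarrow>
     ('a, 'm::{finite,linorder}, 'm) mtx \<Rightarrow> ('a, 'n, 'm) mtx \<Rightarrow> real"
  where "q_factor \<kappa> \<Theta> \<Sigma> X =
    gen_power \<kappa> (minv (mmul3 (minv (ctrans (cholesky \<Sigma>)))
      (mmul3 (ctrans X) (minv \<Theta>) X) (minv (cholesky \<Sigma>))))"

text \<open>The Kotz-Riesz distribution of type II.\<close>

definition kotz_riesz_II ::
    "'w measure \<Rightarrow> ('w \<Rightarrow> ('a::normed_division_algebra, 'n::finite, 'm::{finite,linorder}) mtx) \<Rightarrow>
     (nat \<Rightarrow> real) \<Rightarrow> ('a, 'n, 'm) mtx \<Rightarrow> ('a, 'n, 'n) mtx \<Rightarrow> ('a, 'm, 'm) mtx \<Rightarrow> bool"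
  where "kotz_riesz_II M Y \<kappa> \<mu> \<Theta> \<Sigma> \<longleftrightarrow>
    (let \<beta> = real DIM('a); m = CARD('m); n = CARD('n) in
     has_density M Y (\<lambda>X. complex_of_real (
       \<beta> powr (m * n * \<beta> / 2 - (\<Sum>i = 1..m. \<kappa> i)) * mv_Gamma \<beta> m (n * \<beta> / 2) /
         (pi powr (m * n * \<beta> / 2) * mv_Gamma_neg \<beta> m (n * \<beta> / 2) \<kappa> *
          hdet \<Sigma> powr (n * \<beta> / 2) * hdet \<Theta> powr (m * \<beta> / 2)) *
       etr (- \<beta> *\<^sub>R (minv \<Sigma> \<star> mmul3 (ctrans (X - \<mu>)) (minv \<Theta>) (X - \<mu>))) *
       q_factor \<kappa> \<Theta> \<Sigma> (X - \<mu>))))"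

end

theory Submission
  imports Defs "HOL-Real_Asymp.Real_Asymp"
begin

text \<open>
  Write \<open>Q(X) = tr \<Sigma>\<^sup>-\<^sup>1 X\<^sup>* \<Theta>\<^sup>-\<^sup>1 X\<close> and let \<open>q(X)\<close> be the generalised power factor, \<open>d = \<beta>mn\<close> and
  \<open>\<tau> = \<Sum>\<^sub>i t\<^sub>i\<close>. Both factors are homogeneous, of degrees \<open>2\<close> and \<open>-2\<tau>\<close>. Conditioning on \<open>S = s\<close> and
  substituting, the density of \<open>T\<close> at \<open>X + \<mu>\<close> is the integral of \<open>s\<^bsup>d/2\<^esup> g(\<surd>s X) f(s)\<close> over \<open>s > 0\<close>,
  where \<open>f\<close> and \<open>g\<close> are the densities of \<open>S\<close> and \<open>Y\<close>. By homogeneity this is a constant multiple of \<open>q(X)\<close>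
  times a gamma integral in \<open>s\<close> with rate \<open>\<beta>(1/\<rho> + Q(X))\<close>.

  No structure theory of Hermitian matrices over the algebra is needed, so the octonions require no
  separate treatment: since the total mass is \<open>1\<close>, the gamma integral is finite for almost all \<open>X\<close> with
  \<open>q(X) \<noteq> 0\<close>, and this forces \<open>1 + \<rho> Q(X) > 0\<close> there. Likewise, that \<open>f\<close> is a density forces the
  parameter \<open>\<nu>\<close> to be real.
\<close>

section \<open>Homogeneity of the generalised power\<close>

lemma ctrans_scaleR: "ctrans (r *\<^sub>R X) = r *\<^sub>R ctrans X"
  by (simp add: ctrans_def vec_eq_iff nconj_scaleR)

lemma is_inverse_scaleR:
  assumes "r \<noteq> 0"
  shows "is_inverse (r *\<^sub>R A) B \<longleftrightarrow> is_inverse A (r *\<^sub>R B)"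
proof -
  have j: "(s *\<^sub>R X) \<circ>J Y = s *\<^sub>R (X \<circ>J Y)" "X \<circ>J (s *\<^sub>R Y) = s *\<^sub>R (X \<circ>J Y)"
    for s and X Y :: "'a^'b^'b"
    by (simp_all add: jprod_def mmul_scaleR_left mmul_scaleR_right scaleR_right_distrib)
  \<comment> \<open>The second Jordan identity is quadratic in \<open>A\<close> on the left and
    linear on the right; this cancels the surplus factor \<open>r\<close>.\<close>
  have "(r * r) *\<^sub>R Z = r *\<^sub>R A \<longleftrightarrow> r *\<^sub>R Z = A" for Z
    using assms by (simp flip: scaleR_scaleR)
  then show ?thesis
    using assms by (simp add: is_inverse_def hermitian_def ctrans_scaleR j)
qed

text \<open>Multiplication by \<open>r\<close> maps the inverses of \<open>r *\<^sub>R A\<close>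
  bijectively onto those of \<open>A\<close>, so uniqueness holds for both matrices or for neither.
  In the latter case both sides are the default value 0.\<close>

lemma minv_scaleR:
  assumes "r \<noteq> 0"
  shows "minv (r *\<^sub>R A) = inverse r *\<^sub>R minv A"
proof -
  have iff: "is_inverse (r *\<^sub>R A) B \<longleftrightarrow> is_inverse A (r *\<^sub>R B)" for B
    using assms by (rule is_inverse_scaleR)
  show ?thesis
  proof (cases "\<exists>!B. is_inverse A B")
    case True
    then obtain B where B: "is_inverse A B" and uniq: "\<And>C. is_inverse A C \<Longrightarrow> C = B"
      by blast
    have 1: "minv A = B"
      unfolding minv_def if_P[OF True] using B uniq by (rule the_equality)
    have B': "is_inverse (r *\<^sub>R A) (inverse r *\<^sub>R B)"
      using assms B by (simp add: iff)
    have uniq': "C = inverse r *\<^sub>R B" if "is_inverse (r *\<^sub>R A) C" for C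
      using uniq[of "r *\<^sub>R C"] that assms by (auto simp: iff)
    have ex: "\<exists>!C. is_inverse (r *\<^sub>R A) C" using B' uniq' by (rule ex1I)
    have "minv (r *\<^sub>R A) = inverse r *\<^sub>R B"
      unfolding minv_def if_P[OF ex] using B' uniq' by (rule the_equality)
    then show ?thesis using 1 by simp
  next
    case False
    have "\<not> (\<exists>!C. is_inverse (r *\<^sub>R A) C)"
    proof
      assume "\<exists>!C. is_inverse (r *\<^sub>R A) C"
      then obtain C where C: "is_inverse (r *\<^sub>R A) C"
        and uniq: "\<And>D. is_inverse (r *\<^sub>R A) D \<Longrightarrow> D = C" by blast
      have "is_inverse A (r *\<^sub>R C)" using C by (simp add: iff)
      moreover have "D = r *\<^sub>R C" if "is_inverse A D" for D
        using uniq[of "inverse r *\<^sub>R D"] that assms by (auto simp: iff)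
      ultimately show False using False by blast
    qed
    then show ?thesis using False by (simp add: minv_def)
  qed
qed

lemma eigenvalues_on_scaleR:
  assumes "eigenvalues_on I A \<alpha>"
  shows "eigenvalues_on I (r *\<^sub>R A) (\<lambda>i. r * \<alpha> i)"
proof -
  from assms obtain E where
    E: "\<forall>i\<in>I. hermitian (E i) \<and> E i \<noteq> 0 \<and> E i \<circ>J E i = E i"
       "\<forall>i\<in>I. \<forall>j\<in>I. i \<noteq> j \<longrightarrow> E i \<circ>J E j = 0" "(\<Sum>i\<in>I. E i) = psub I (mat 1)"
    and A: "psub I A = (\<Sum>i\<in>I. \<alpha> i *\<^sub>R E i)"
    unfolding eigenvalues_on_def by (elim exE conjE)
  have "psub I (r *\<^sub>R A) = r *\<^sub>R psub I A" by (simp add: psub_def vec_eq_iff)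
  then have "psub I (r *\<^sub>R A) = (\<Sum>i\<in>I. (r * \<alpha> i) *\<^sub>R E i)"
    by (simp add: A scaleR_sum_right)
  with E show ?thesis unfolding eigenvalues_on_def by (intro exI[of _ E] conjI)
qed

text \<open>The possible products of eigenvalues of \<open>A\<close> are carried to those of the
  scaled matrix by the factor \<open>r ^ card I\<close>, and back by scaling with
  \<open>inverse r\<close>. Hence uniqueness transfers, and a missing or ambiguous product gives 0
  on both sides.\<close>

lemma det_on_scaleR:
  fixes A :: "'a::normed_division_algebra^'m^'m"
  assumes "r \<noteq> 0"
  shows "det_on I (r *\<^sub>R A) = r ^ card I * det_on I A"
proof -
  define P where "P B d \<longleftrightarrow> (\<exists>\<alpha>. eigenvalues_on I B \<alpha> \<and> d = (\<Prod>i\<in>I. \<alpha> i))"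
    for B :: "'a^'m^'m" and d :: real
  have det: "det_on I B = (if \<exists>!d. P B d then THE d. P B d else 0)" for B :: "'a^'m^'m"
    by (simp add: det_on_def P_def)
  have up: "P (s *\<^sub>R B) (s ^ card I * d)" if "P B d" for s d and B :: "'a^'m^'m"
    using that eigenvalues_on_scaleR[of I B _ s] unfolding P_def
    by (fastforce simp: prod.distrib)
  have down: "P A (d / r ^ card I)" if "P (r *\<^sub>R A) d" for d
    using up[OF that, of "inverse r"] assms by (simp add: field_simps)
  show ?thesis
  proof (cases "\<exists>!d. P A d")
    case True
    then obtain d where d: "P A d" and uniq: "\<And>e. P A e \<Longrightarrow> e = d" by blast
    have uniq': "e = r ^ card I * d" if "P (r *\<^sub>R A) e" for e
      using uniq[OF down[OF that]] assms by (simp add: field_simps)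
    have "(THE d. P A d) = d" using d uniq by (rule the_equality)
    moreover have "(THE e. P (r *\<^sub>R A) e) = r ^ card I * d"
      using up[OF d] uniq' by (rule the_equality)
    moreover have "\<exists>!e. P (r *\<^sub>R A) e" using up[OF d] uniq' by blast
    ultimately show ?thesis using True by (simp add: det)
  next
    case False
    have "\<not> (\<exists>!e. P (r *\<^sub>R A) e)"
    proof
      assume "\<exists>!e. P (r *\<^sub>R A) e"
      then obtain e where e: "P (r *\<^sub>R A) e" and uniq: "\<And>x. P (r *\<^sub>R A) x \<Longrightarrow> x = e" by blast
      have "x = e / r ^ card I" if "P A x" for x
        using uniq[OF up[OF that]] assms by (simp add: field_simps)
      then show False using down[OF e] False by blast
    qed
    then show ?thesis using False by (simp add: det)
  qed
qed

text \<open>The rank \<open>h\<close> is strictly increasing, hence a bijection onto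
  \<open>{1..CARD('m)}\<close>, and \<open>leading p\<close> is the preimage of
  \<open>{1..p}\<close>. The cardinality is needed as the degree of the leading minor.\<close>

lemma card_leading:
  assumes "p \<le> CARD('m::{finite,linorder})"
  shows "card (leading p :: 'm set) = p"
proof -
  define h :: "'m \<Rightarrow> nat" where "h i = card {j. j \<le> i}" for i
  have mono: "h i < h j" if "i < j" for i j
    unfolding h_def
  proof (rule psubset_card_mono)
    have "{k. k \<le> i} \<subseteq> {k. k \<le> j}" using that by auto
    moreover have "j \<in> {k. k \<le> j} - {k. k \<le> i}" using that by simp
    ultimately show "{k. k \<le> i} \<subset> {k. k \<le> j}" by blast
  qed simp
  have inj: "inj h"
    by (metis injI linorder_neq_iff less_irrefl mono)
  have "h ` UNIV \<subseteq> {1..CARD('m)}"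
  proof safe
    fix i :: 'm
    have "{i} \<subseteq> {j. j \<le> i}" by auto
    then have "1 \<le> h i" unfolding h_def using card_mono[of "{j. j \<le> i}" "{i}"] by simp
    moreover have "h i \<le> CARD('m)" unfolding h_def by (intro card_mono) auto
    ultimately show "h i \<in> {1..CARD('m)}" by simp
  qed
  then have img: "h ` UNIV = {1..CARD('m)}"
    using inj by (intro card_subset_eq) (auto simp: card_image)
  have "h ` leading p = {1..p}"
  proof (intro set_eqI iffI)
    fix x assume "x \<in> h ` leading p"
    then show "x \<in> {1..p}" using img by (auto simp: leading_def h_def)
  next
    fix x assume "x \<in> {1..p}"
    moreover from this have "x \<in> h ` UNIV" unfolding img using assms by auto
    ultimately show "x \<in> h ` leading p" by (auto simp: leading_def h_def)
  qed
  moreover have "card (h ` leading p) = card (leading p :: 'm set)"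
    using inj by (intro card_image) (auto intro: inj_on_subset)
  ultimately show ?thesis by simp
qed

text \<open>The leading minor of size \<open>p\<close> is homogeneous of degree \<open>p\<close>;
  summation by parts (\<open>abel\<close>) collapses the weighted differences of exponents to the
  plain sum.\<close>

lemma gen_power_scaleR:
  fixes A :: "('a::normed_division_algebra, 'm::{finite,linorder}, 'm) mtx"
  assumes "r > 0"
  shows "gen_power \<kappa> (r *\<^sub>R A) = r powr (\<Sum>i=1..CARD('m). \<kappa> i) * gen_power \<kappa> A"
proof -
  have abel: "real m * \<kappa> m + (\<Sum>i = 1..<m. real i * (\<kappa> i - \<kappa> (i + 1))) = (\<Sum>i = 1..m. \<kappa> i)"
    if "m \<ge> 1" for m
    using that
  proof (induction m rule: dec_induct)
    case (step n)
    then show ?case by (simp add: algebra_simps)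
  qed simp
  have det: "det_on (leading p) (r *\<^sub>R A) powr e = r powr (real p * e) * det_on (leading p) A powr e"
    if "p \<le> CARD('m)" for p e
    using assms that
    by (simp add: det_on_scaleR card_leading powr_mult powr_powr flip: powr_realpow)
  have "gen_power \<kappa> (r *\<^sub>R A) =
      r powr (real CARD('m) * \<kappa> CARD('m)) * (\<Prod>i = 1..<CARD('m). r powr (real i * (\<kappa> i - \<kappa> (i + 1))))
      * gen_power \<kappa> A"
    unfolding gen_power_def by (simp add: det prod.distrib)
  also have "(\<Prod>i = 1..<CARD('m). r powr (real i * (\<kappa> i - \<kappa> (i + 1)))) =
      r powr (\<Sum>i = 1..<CARD('m). real i * (\<kappa> i - \<kappa> (i + 1)))"
    using assms by (simp add: powr_sum)
  finally show ?thesis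
    using abel[of "CARD('m)"] by (simp flip: powr_add)
qed

lemma gen_power_nonneg: "gen_power \<kappa> A \<ge> 0"
  by (auto simp: gen_power_def intro!: mult_nonneg_nonneg prod_nonneg)

lemma mmul3_scaleR:
  "mmul3 (r *\<^sub>R A) B C = r *\<^sub>R mmul3 A B C"
  "mmul3 A (r *\<^sub>R B) C = r *\<^sub>R mmul3 A B C"
  "mmul3 A B (r *\<^sub>R C) = r *\<^sub>R mmul3 A B C"
  by (simp_all add: mmul3_def mmul_scaleR_left mmul_scaleR_right scaleR_right_distrib)

lemma q_factor_nonneg: "q_factor \<kappa> \<Theta> \<Sigma> X \<ge> 0"
  by (simp add: q_factor_def gen_power_nonneg)

text \<open>The matrix under the outermost inverse is quadratic in \<open>X\<close>, so the argument
  of the generalised power scales by \<open>inverse (r * r)\<close>.\<close>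

lemma q_factor_scaleR:
  fixes \<Sigma> :: "('a::normed_division_algebra, 'm::{finite,linorder}, 'm) mtx"
  assumes "r > 0"
  shows "q_factor \<kappa> \<Theta> \<Sigma> (r *\<^sub>R X) = r powr (- 2 * (\<Sum>i=1..CARD('m). \<kappa> i)) * q_factor \<kappa> \<Theta> \<Sigma> X"
proof -
  have "inverse (r * r) powr K = r powr (- 2 * K)" for K
    using assms by (simp add: powr_def ln_inverse ln_mult)
  then show ?thesis
    using assms by (simp add: q_factor_def ctrans_scaleR mmul3_scaleR minv_scaleR gen_power_scaleR)
qed

section \<open>The trace form: homogeneity and continuity\<close>

lemma re_trace_scaleR: "re_trace (r *\<^sub>R A) = r * re_trace A"
  by (simp add: re_trace_def inner_sum_left sum_distrib_left)

lemma re_trace_minus: "re_trace (- A) = - re_trace A"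
  using re_trace_scaleR[of "-1" A] by simp

definition quad_form ::
    "('a::normed_division_algebra, 'n::finite, 'n) mtx \<Rightarrow> ('a, 'm::finite, 'm) mtx \<Rightarrow> ('a, 'n, 'm) mtx \<Rightarrow> real"
  where "quad_form \<Theta> \<Sigma> X = re_trace (minv \<Sigma> \<star> mmul3 (ctrans X) (minv \<Theta>) X)"

lemma quad_form_scaleR: "quad_form \<Theta> \<Sigma> (r *\<^sub>R X) = r\<^sup>2 * quad_form \<Theta> \<Sigma> X"
  by (simp add: quad_form_def ctrans_scaleR mmul3_scaleR mmul_scaleR_right re_trace_scaleR power2_eq_square)

text \<open>Multiplicativity of the norm makes the product a bounded bilinear map, with bound
  1.\<close>

lemma continuous_on_nda_mult:
  fixes f g :: "'b::topological_space \<Rightarrow> 'a::normed_division_algebra"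
  assumes "continuous_on S f" "continuous_on S g"
  shows "continuous_on S (\<lambda>x. f x * g x)"
proof -
  have "bounded_bilinear ((*) :: 'a \<Rightarrow> 'a \<Rightarrow> 'a)"
    by unfold_locales
      (auto simp: nda_add_left nda_add_right nda_scaleR_left nda_scaleR_right nda_norm_mult
        intro!: exI[of _ 1])
  then show ?thesis using assms by (rule bounded_bilinear.continuous_on)
qed

lemma continuous_on_mmul:
  assumes "continuous_on S f" "continuous_on S g"
  shows "continuous_on S (\<lambda>x. f x \<star> g x)"
  unfolding mmul_def
  by (intro continuous_on_vec_lambda continuous_on_sum continuous_on_nda_mult
      continuous_on_component assms)

lemma continuous_on_ctrans:
  assumes "continuous_on S f"
  shows "continuous_on S (\<lambda>x. ctrans (f x))"
  unfolding ctrans_def nconj_def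
  by (intro continuous_on_vec_lambda continuous_intros continuous_on_component assms)

text \<open>The inverses of \<open>\<Theta>\<close> and \<open>\<Sigma>\<close> are constants here,
  so only products and conjugate transposes of \<open>X\<close> are involved. Measurability of the
  form follows, and from it that of the generalised power factor.\<close>

lemma continuous_on_quad_form: "continuous_on S (quad_form \<Theta> \<Sigma>)"
  unfolding quad_form_def[abs_def] re_trace_def mmul3_def
  by (intro continuous_intros continuous_on_mmul continuous_on_ctrans continuous_on_component)

section \<open>Gamma integrals\<close>

lemma nn_integral_Gamma_scaled:
  assumes "b > 0" "c > 0"
  shows "(\<integral>\<^sup>+ s. ennreal (indicator {0<..} s * s powr (b - 1) * exp (- c * s)) \<partial>lborel)
    = ennreal (Gamma b * c powr - b)"
proof -
  let ?I = "\<integral>\<^sup>+ s. ennreal (indicator {0<..} s * s powr (b - 1) * exp (- c * s)) \<partial>lborel"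
  have "ennreal (Gamma b) =
      (\<integral>\<^sup>+ s. ennreal (indicator {0..} s * s powr (b - 1) / exp s) \<partial>lborel)"
    using assms(1) by (rule Gamma_conv_nn_integral_real)
  also have "\<dots> = ennreal \<bar>c\<bar> * (\<integral>\<^sup>+ s. ennreal (indicator {0..} (0 + c * s) * (0 + c * s) powr (b - 1) / exp (0 + c * s)) \<partial>lborel)"
    using assms by (intro nn_integral_real_affine) auto
  \<comment> \<open>The indicator may change from \<open>{0..}\<close> to \<open>{0<..}\<close>
    pointwise, because \<open>0 powr (b - 1) = 0\<close>.\<close>
  also have "(\<integral>\<^sup>+ s. ennreal (indicator {0..} (0 + c * s) * (0 + c * s) powr (b - 1) / exp (0 + c * s)) \<partial>lborel)
      = (\<integral>\<^sup>+ s. ennreal (c powr (b - 1)) * ennreal (indicator {0<..} s * s powr (b - 1) * exp (- c * s)) \<partial>lborel)"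
    using assms
    by (intro nn_integral_cong)
      (auto simp: indicator_def powr_mult exp_minus field_simps zero_le_mult_iff simp flip: ennreal_mult')
  also have "\<dots> = ennreal (c powr (b - 1)) * ?I"
    by (rule nn_integral_cmult) simp
  also have "ennreal \<bar>c\<bar> * (ennreal (c powr (b - 1)) * ?I) = ennreal (\<bar>c\<bar> * c powr (b - 1)) * ?I"
    by (simp add: mult.assoc ennreal_mult')
  also have "\<bar>c\<bar> * c powr (b - 1) = c powr b"
    using assms by (simp add: powr_diff)
  finally have *: "ennreal (Gamma b) = ennreal (c powr b) * ?I" .
  have "ennreal (c powr - b) * ennreal (Gamma b) = ennreal (c powr - b * c powr b) * ?I"
    by (simp add: * mult.assoc ennreal_mult')
  also have "c powr - b * c powr b = 1" using assms by (simp flip: powr_add)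
  finally show ?thesis using assms by (simp add: mult.commute ennreal_mult' less_imp_le)
qed

lemma ennreal_eq_top_if_unbounded:
  fixes x :: ennreal
  assumes "eventually (\<lambda>\<epsilon>. ennreal (f \<epsilon>) \<le> x) (at_right (0::real))" "filterlim f at_top (at_right 0)"
  shows "x = \<infinity>"
proof (rule ccontr)
  assume "x \<noteq> \<infinity>"
  then obtain r where r: "x = ennreal r" "r \<ge> 0" by (cases x) auto
  have "eventually (\<lambda>\<epsilon>. f \<epsilon> > r) (at_right 0)"
    using assms(2) by (simp add: filterlim_at_top_dense)
  with assms(1) have "eventually (\<lambda>\<epsilon>::real. False) (at_right 0)"
    by eventually_elim (use r in \<open>auto simp: ennreal_le_iff\<close>)
  then show False by (simp add: trivial_limit_at_right_real)
qed

text \<open>Comparison with convergent integrals whose values blow up as \<epsilon> tends to 0. If b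
  > 0 and c \<le> 0, the rate \<open>c\<close> is replaced by \<epsilon>, giving the lower bound
  \<open>Gamma b * \<epsilon> powr - b\<close>. If b \<le> 0, the integrand on (0, 1] is at least
  \<open>exp (- \<bar>c\<bar>) * s powr (\<epsilon> - 1)\<close>, with integral
  \<open>exp (- \<bar>c\<bar>) / \<epsilon>\<close>.\<close>

lemma nn_integral_Gamma_scaled_diverges:
  assumes "b \<le> 0 \<or> c \<le> 0"
  shows "(\<integral>\<^sup>+ s. ennreal (indicator {0<..} s * s powr (b - 1) * exp (- c * s)) \<partial>lborel) = \<infinity>"
    (is "?I = _")
proof (cases "b \<le> 0")
  case False
  then have b: "b > 0" and l: "c \<le> 0" using assms by auto
  show ?thesis
  proof (rule ennreal_eq_top_if_unbounded)
    show "\<forall>\<^sub>F \<epsilon> in at_right 0. ennreal (Gamma b * \<epsilon> powr - b) \<le> ?I"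
      using eventually_at_right_less
    proof eventually_elim
      case (elim \<epsilon>)
      show ?case
        unfolding nn_integral_Gamma_scaled[OF b elim, symmetric]
        using l elim
        by (intro nn_integral_mono ennreal_leI)
          (auto simp: indicator_def intro!: mult_left_mono mult_right_mono)
    qed
    have "filterlim (\<lambda>\<epsilon>::real. \<epsilon> powr - b) at_top (at_right 0)" using b by real_asymp
    then show "LIM \<epsilon> at_right 0. Gamma b * \<epsilon> powr - b :> at_top"
      using b by (intro filterlim_tendsto_pos_mult_at_top[OF tendsto_const]) auto
  qed
next
  case True
  show ?thesis
  proof (rule ennreal_eq_top_if_unbounded)
    show "\<forall>\<^sub>F \<epsilon> in at_right 0. ennreal (exp (- \<bar>c\<bar>) * (1 / \<epsilon>)) \<le> ?I"
      using eventually_at_right_less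
    proof eventually_elim
      case (elim \<epsilon>)
      have "((\<lambda>s. s powr (\<epsilon> - 1)) has_integral (1 powr (\<epsilon> - 1 + 1) / (\<epsilon> - 1 + 1))) {0..1}"
        using elim by (intro has_integral_powr_from_0) auto
      then have "ennreal (1 / \<epsilon>) = (\<integral>\<^sup>+ s. ennreal (s powr (\<epsilon> - 1)) * indicator {0..1} s \<partial>lborel)"
        by (subst nn_integral_has_integral_lebesgue'[of "{0..1::real}" "\<lambda>s. s powr (\<epsilon> - 1)" "1 / \<epsilon>"]) auto
      then have "ennreal (exp (- \<bar>c\<bar>) * (1 / \<epsilon>)) =
          (\<integral>\<^sup>+ s. ennreal (exp (- \<bar>c\<bar>)) * (ennreal (s powr (\<epsilon> - 1)) * indicator {0..1} s) \<partial>lborel)"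
        using elim by (subst nn_integral_cmult) (simp_all add: \<open>ennreal (1 / \<epsilon>) = _\<close>[symmetric] flip: ennreal_mult')
      also have "\<dots> \<le> ?I"
      proof (rule nn_integral_mono)
        fix s :: real
        have "exp (- \<bar>c\<bar>) * s powr (\<epsilon> - 1) \<le> s powr (b - 1) * exp (- c * s)" if s: "0 < s" "s \<le> 1"
        proof -
          have "c * s \<le> \<bar>c\<bar> * 1" using s by (intro mult_mono) auto
          moreover have "s powr (\<epsilon> - 1) \<le> s powr (b - 1)"
            using s True elim by (intro powr_mono') auto
          ultimately show ?thesis
            by (subst mult.commute) (intro mult_mono, auto)
        qed
        \<comment> \<open>At \<open>s = 0\<close> both sides vanish, again since 0 to any real power
          is 0.\<close>
        then show "ennreal (exp (- \<bar>c\<bar>)) * (ennreal (s powr (\<epsilon> - 1)) * indicator {0..1} s)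
            \<le> ennreal (indicator {0<..} s * s powr (b - 1) * exp (- c * s))"
          by (cases "s = 0") (auto simp: indicator_def simp flip: ennreal_mult' intro!: ennreal_leI)
      qed
      finally show ?case .
    qed
    show "LIM \<epsilon> at_right 0. exp (- \<bar>c\<bar>) * (1 / \<epsilon>) :> at_top" 
      by (intro filterlim_tendsto_pos_mult_at_top[OF tendsto_const]) (simp, real_asymp)
  qed
qed

section \<open>Scale mixtures\<close>

lemma nn_integral_lborel_affine:
  fixes f :: "'b::euclidean_space \<Rightarrow> ennreal"
  assumes [measurable]: "f \<in> borel_measurable borel" and c: "c \<noteq> 0"
  shows "(\<integral>\<^sup>+ x. f x \<partial>lborel) = ennreal (\<bar>c\<bar> ^ DIM('b)) * (\<integral>\<^sup>+ x. f (t + c *\<^sub>R x) \<partial>lborel)"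
  by (subst lborel_affine[OF c, of t])
    (simp add: nn_integral_density nn_integral_distr nn_integral_cmult)

text \<open>A product of sigma-finite measures is determined by its values on rectangles, and there
  the claim is the product formula of independence.\<close>

lemma (in prob_space) distr_pair_indep_rvs:
  assumes "indep_rvs M X Y"
  shows "distr M borel X \<Otimes>\<^sub>M distr M borel Y = distr M (borel \<Otimes>\<^sub>M borel) (\<lambda>\<omega>. (X \<omega>, Y \<omega>))"
proof (rule pair_measure_eqI)
  have [measurable]: "X \<in> borel_measurable M" "Y \<in> borel_measurable M"
    and ind: "indep_set {X -` A \<inter> space M | A. A \<in> sets borel} {Y -` B \<inter> space M | B. B \<in> sets borel}"
    using assms by (simp_all add: indep_rvs_def)
  interpret X: prob_space "distr M borel X" by (rule prob_space_distr) simp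
  interpret Y: prob_space "distr M borel Y" by (rule prob_space_distr) simp
  show "sigma_finite_measure (distr M borel X)" "sigma_finite_measure (distr M borel Y)" ..
  show "sets (distr M borel X \<Otimes>\<^sub>M distr M borel Y) =
      sets (distr M (borel \<Otimes>\<^sub>M borel) (\<lambda>\<omega>. (X \<omega>, Y \<omega>)))"
    by (simp cong: sets_pair_measure_cong)
  fix A B assume "A \<in> sets (distr M borel X)" "B \<in> sets (distr M borel Y)"
  then have [measurable]: "A \<in> sets borel" "B \<in> sets borel" by auto
  have "prob (X -` A \<inter> space M \<inter> (Y -` B \<inter> space M)) = prob (X -` A \<inter> space M) * prob (Y -` B \<inter> space M)"
    by (rule indep_setD[OF ind]) auto
  moreover have "X -` A \<inter> space M \<inter> (Y -` B \<inter> space M) = (\<lambda>\<omega>. (X \<omega>, Y \<omega>)) -` (A \<times> B) \<inter> space M"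
    by auto
  ultimately show "emeasure (distr M borel X) A * emeasure (distr M borel Y) B =
      emeasure (distr M (borel \<Otimes>\<^sub>M borel) (\<lambda>\<omega>. (X \<omega>, Y \<omega>))) (A \<times> B)"
    by (simp add: emeasure_distr emeasure_eq_measure ennreal_mult')
qed

text \<open>Independence gives the joint density \<open>f s * g y\<close>. The probability of a
  Borel set is an iterated integral; the inner variable is transformed at fixed \<open>s\<close>,
  and Fubini then moves the integral over \<open>s\<close> inside, where it is the asserted
  density.\<close>

lemma (in prob_space) distributed_scale_mixture:
  fixes S :: "'a \<Rightarrow> real" and Y :: "'a \<Rightarrow> 'b::euclidean_space"
  assumes S: "distributed M lborel S f" and Y: "distributed M lborel Y g"
    and indep: "indep_rvs M S Y" and f0: "\<And>s. s \<le> 0 \<Longrightarrow> f s = 0"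
  shows "distributed M lborel (\<lambda>\<omega>. (1 / sqrt (S \<omega>)) *\<^sub>R Y \<omega> + \<mu>)
    (\<lambda>x. \<integral>\<^sup>+ s. f s * (ennreal (sqrt s ^ DIM('b)) * g (sqrt s *\<^sub>R (x - \<mu>))) \<partial>lborel)"
    (is "distributed M lborel ?T ?h")
proof -
  have [measurable]: "f \<in> borel_measurable borel" "g \<in> borel_measurable borel"
    "S \<in> borel_measurable M" "Y \<in> borel_measurable M"
    using S Y by (auto simp: distributed_def)
  have "distr M lborel S \<Otimes>\<^sub>M distr M lborel Y = distr M (lborel \<Otimes>\<^sub>M lborel) (\<lambda>\<omega>. (S \<omega>, Y \<omega>))"
    using distr_pair_indep_rvs[OF indep]
    by (simp cong: distr_cong sets_pair_measure_cong)
  then have SY: "distributed M (lborel \<Otimes>\<^sub>M lborel) (\<lambda>\<omega>. (S \<omega>, Y \<omega>)) (\<lambda>(s, y). f s * g y)"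
    by (intro distributed_joint_indep' S Y) (rule lborel.sigma_finite_measure_axioms)+
  have [measurable]: "(\<lambda>(s, x). f s * (ennreal (sqrt s ^ DIM('b)) * g (sqrt s *\<^sub>R (x - \<mu>))))
      \<in> borel_measurable (borel \<Otimes>\<^sub>M borel)"
    by measurable
  have h: "?h \<in> borel_measurable lborel"
    by measurable
  have "distr M lborel ?T = density lborel ?h"
  proof (rule measure_eqI)
    fix A assume "A \<in> sets (distr M lborel ?T)"
    then have [measurable]: "A \<in> sets borel" by simp
    have "emeasure (distr M lborel ?T) A = (\<integral>\<^sup>+ x. indicator A x \<partial>distr M lborel ?T)"
      by simp
    also have "\<dots> = (\<integral>\<^sup>+ \<omega>. indicator A (?T \<omega>) \<partial>M)"
      by (rule nn_integral_distr) simp_all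
    also have "\<dots> = (\<integral>\<^sup>+ z. (\<lambda>(s, y). f s * g y) z * indicator A ((1 / sqrt (fst z)) *\<^sub>R snd z + \<mu>)
        \<partial>(lborel \<Otimes>\<^sub>M lborel))"
      by (subst distributed_nn_integral[OF SY]) auto
    also have "\<dots> = (\<integral>\<^sup>+ s. \<integral>\<^sup>+ y. f s * g y * indicator A ((1 / sqrt s) *\<^sub>R y + \<mu>) \<partial>lborel \<partial>lborel)"
      by (subst lborel.nn_integral_fst[symmetric]) auto
    also have "\<dots> = (\<integral>\<^sup>+ s. \<integral>\<^sup>+ x. f s * (ennreal (sqrt s ^ DIM('b)) * g (sqrt s *\<^sub>R (x - \<mu>))) * indicator A x
        \<partial>lborel \<partial>lborel)"
    proof (rule nn_integral_cong)
      fix s :: real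
      show "(\<integral>\<^sup>+ y. f s * g y * indicator A ((1 / sqrt s) *\<^sub>R y + \<mu>) \<partial>lborel) =
          (\<integral>\<^sup>+ x. f s * (ennreal (sqrt s ^ DIM('b)) * g (sqrt s *\<^sub>R (x - \<mu>))) * indicator A x \<partial>lborel)"
      \<comment> \<open>For s > 0 the substitution y = sqrt s (x - \<mu>) turns the argument of the
        indicator into x and contributes the Jacobian \<open>sqrt s ^ DIM('b)\<close>. For s \<le> 0
        it would be degenerate, but there \<open>f0\<close> makes both sides 0.\<close>
      proof (cases "s > 0")
        case True
        have eq: "- (sqrt s *\<^sub>R \<mu>) + sqrt s *\<^sub>R x = sqrt s *\<^sub>R (x - \<mu>)" for x
          by (simp add: algebra_simps)
        have "(\<integral>\<^sup>+ y. f s * g y * indicator A ((1 / sqrt s) *\<^sub>R y + \<mu>) \<partial>lborel) =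
            ennreal (\<bar>sqrt s\<bar> ^ DIM('b)) *
            (\<integral>\<^sup>+ x. f s * g (- (sqrt s *\<^sub>R \<mu>) + sqrt s *\<^sub>R x) *
              indicator A ((1 / sqrt s) *\<^sub>R (- (sqrt s *\<^sub>R \<mu>) + sqrt s *\<^sub>R x) + \<mu>) \<partial>lborel)"
          using True by (intro nn_integral_lborel_affine) simp_all
        also have "\<dots> = ennreal (sqrt s ^ DIM('b)) * (\<integral>\<^sup>+ x. f s * g (sqrt s *\<^sub>R (x - \<mu>)) * indicator A x \<partial>lborel)"
          unfolding eq using True by simp
        also have "\<dots> = (\<integral>\<^sup>+ x. ennreal (sqrt s ^ DIM('b)) * (f s * g (sqrt s *\<^sub>R (x - \<mu>)) * indicator A x) \<partial>lborel)"
          using True by (subst nn_integral_cmult) simp_all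
        finally show ?thesis by (simp add: mult_ac)
      qed (simp add: f0)
    qed
    also have "\<dots> = (\<integral>\<^sup>+ x. \<integral>\<^sup>+ s. f s * (ennreal (sqrt s ^ DIM('b)) * g (sqrt s *\<^sub>R (x - \<mu>))) * indicator A x
        \<partial>lborel \<partial>lborel)"
      by (rule lborel_pair.Fubini') measurable
    also have "\<dots> = (\<integral>\<^sup>+ x. ?h x * indicator A x \<partial>lborel)"
      by (subst nn_integral_multc) simp_all
    also have "\<dots> = emeasure (density lborel ?h) A"
      using h by (subst emeasure_density) simp_all
    finally show "emeasure (distr M lborel ?T) A = emeasure (density lborel ?h) A" .
  qed simp
  then show ?thesis using h by (simp add: distributed_def)
qed

section \<open>Almost everywhere nonnegativity forces a real exponent\<close>

lemma AE_lborel_imp_everywhere: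
  fixes P :: "'b::euclidean_space \<Rightarrow> bool"
  assumes "AE x in lborel. P x" "open {x. \<not> P x}"
  shows "P x"
proof (rule ccontr)
  assume "\<not> P x"
  have "{x. \<not> P x} \<in> null_sets lborel"
    using assms AE_iff_null_sets[of "{x. \<not> P x}" lborel] by simp
  then have "negligible {x. \<not> P x}"
    by (simp add: negligible_iff_null_sets null_sets_completionI)
  with assms(2) \<open>\<not> P x\<close> show False using open_not_negligible by blast
qed

text \<open>The exceptional set is open by continuity, hence empty, so the sign condition holds for
  every s > 0. But \<open>s powr z\<close> has argument \<open>Im z * ln s\<close>, which rotates
  with s unless \<open>Im z = 0\<close>.\<close>

lemma exponent_real_if_AE_nonneg:
  fixes z K :: complex
  assumes AE: "AE s in lborel. s > 0 \<longrightarrow> K * of_real s powr z \<in> \<real>\<^sub>\<ge>\<^sub>0" and "K \<noteq> 0"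
  shows "Im z = 0"
proof -
  have "continuous_on {0<..} (\<lambda>s::real. K * of_real s powr z)"
    by (intro continuous_intros) auto
  then have "open ({0<..} \<inter> (\<lambda>s. K * of_real s powr z) -` (- \<real>\<^sub>\<ge>\<^sub>0))"
    by (rule continuous_open_preimage) (auto intro: open_Compl)
  also have "{0<..} \<inter> (\<lambda>s. K * of_real s powr z) -` (- \<real>\<^sub>\<ge>\<^sub>0) =
      {s::real. \<not> (s > 0 \<longrightarrow> K * of_real s powr z \<in> \<real>\<^sub>\<ge>\<^sub>0)}" by auto
  finally have all: "K * of_real s powr z \<in> \<real>\<^sub>\<ge>\<^sub>0" if "s > 0" for s :: real
    using AE_lborel_imp_everywhere[OF AE, of s] that by blast
  have K: "K \<in> \<real>\<^sub>\<ge>\<^sub>0" using all[of 1] by simp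
  show "Im z = 0"
  proof (rule ccontr)
    assume nz: "Im z \<noteq> 0"
    \<comment> \<open>Chosen so that \<open>Im z * ln s = pi\<close>: at this point the power is a
      negative real, while \<open>s = 1\<close> has already shown \<open>K\<close> to be
      nonnegative.\<close>
    define s where "s = exp (pi / Im z)"
    have "of_real s powr z = exp (z * of_real (pi / Im z))"
      by (simp add: s_def powr_def Ln_of_real exp_of_real flip: of_real_divide)
    also have "\<dots> = - of_real (exp (Re z * pi / Im z))"
      using nz by (simp add: exp_eq_polar complex_eq_iff cis.ctr)
    finally have "- (K * of_real (exp (Re z * pi / Im z))) \<in> \<real>\<^sub>\<ge>\<^sub>0"
      using all[of s] by (simp add: s_def)
    then show False
      using K \<open>K \<noteq> 0\<close> 
      by (auto simp: complex_nonneg_Reals_iff complex_eq_iff mult_le_0_iff)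
  qed
qed

text \<open>The shape \<open>b\<close> of the resulting gamma integral collects the powers of s:
  \<open>a\<close> from the density of \<open>S\<close>, half the dimension from the Jacobian, and -
  \<tau> from the homogeneity of \<open>q\<close>.\<close>

lemma (in prob_space) distributed_scale_mixture_homogeneous:
  fixes S :: "'a \<Rightarrow> real" and Y :: "'a \<Rightarrow> 'b::euclidean_space" and q Q :: "'b \<Rightarrow> real"
  assumes S: "distributed M lborel S (\<lambda>s. ennreal (if s > 0 then A * s powr (a - 1) * exp (- p * s) else 0))"
    and Y: "distributed M lborel Y (\<lambda>x. ennreal (C * exp (- \<beta> * Q x) * q x))"
    and indep: "indep_rvs M S Y"
    and A: "A > 0" and C: "C > 0"
    and q_nonneg: "\<And>x. q x \<ge> 0" and q: "\<And>r x. r > 0 \<Longrightarrow> q (r *\<^sub>R x) = r powr (- 2 * \<tau>) * q x"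
    and Q: "\<And>r x. Q (r *\<^sub>R x) = r\<^sup>2 * Q x"
    and [measurable]: "q \<in> borel_measurable borel" "Q \<in> borel_measurable borel"
  defines "b \<equiv> a + DIM('b) / 2 - \<tau>"
  shows "AE x in lborel. q (x - \<mu>) \<noteq> 0 \<longrightarrow> b > 0 \<and> p + \<beta> * Q (x - \<mu>) > 0"
    and "distributed M lborel (\<lambda>\<omega>. (1 / sqrt (S \<omega>)) *\<^sub>R Y \<omega> + \<mu>)
      (\<lambda>x. ennreal (A * C * Gamma b * (p + \<beta> * Q (x - \<mu>)) powr - b * q (x - \<mu>)))"
proof -
  let ?T = "\<lambda>\<omega>. (1 / sqrt (S \<omega>)) *\<^sub>R Y \<omega> + \<mu>"
  let ?f = "\<lambda>s. ennreal (if s > 0 then A * s powr (a - 1) * exp (- p * s) else 0)"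
  let ?g = "\<lambda>x. ennreal (C * exp (- \<beta> * Q x) * q x)"
  let ?I = "\<lambda>c. \<integral>\<^sup>+ s. ennreal (indicator {0<..} s * s powr (b - 1) * exp (- c * s)) \<partial>lborel"
  define h where "h x = (\<integral>\<^sup>+ s. ?f s * (ennreal (sqrt s ^ DIM('b)) * ?g (sqrt s *\<^sub>R (x - \<mu>))) \<partial>lborel)" for x
  have T: "distributed M lborel ?T h"
    unfolding h_def by (rule distributed_scale_mixture[OF S Y indep]) simp
  have h: "h x = ennreal (A * C * q (x - \<mu>)) * ?I (p + \<beta> * Q (x - \<mu>))" for x
  proof -
    have "h x = (\<integral>\<^sup>+ s. ennreal (A * C * q (x - \<mu>)) *
        ennreal (indicator {0<..} s * s powr (b - 1) * exp (- (p + \<beta> * Q (x - \<mu>)) * s)) \<partial>lborel)"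
      unfolding h_def
    proof (rule nn_integral_cong)
      fix s :: real
      show "?f s * (ennreal (sqrt s ^ DIM('b)) * ?g (sqrt s *\<^sub>R (x - \<mu>))) =
          ennreal (A * C * q (x - \<mu>)) *
          ennreal (indicator {0<..} s * s powr (b - 1) * exp (- (p + \<beta> * Q (x - \<mu>)) * s))"
      proof (cases "s > 0")
        case True
        have 1: "sqrt s ^ DIM('b) = s powr (DIM('b) / 2)"
          using True by (simp add: powr_half_sqrt[symmetric] powr_powr flip: powr_realpow)
        have 2: "q (sqrt s *\<^sub>R (x - \<mu>)) = s powr - \<tau> * q (x - \<mu>)"
          using True by (simp add: q powr_half_sqrt[symmetric] powr_powr)
        have 3: "Q (sqrt s *\<^sub>R (x - \<mu>)) = s * Q (x - \<mu>)"
          using True by (simp add: Q)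
        have 4: "s powr (b - 1) = s powr (a - 1) * s powr (DIM('b) / 2) * s powr - \<tau>"
          by (simp add: b_def flip: powr_add) (simp add: algebra_simps)
        have 5: "exp (- (p + \<beta> * Q (x - \<mu>)) * s) = exp (- p * s) * exp (- \<beta> * (s * Q (x - \<mu>)))"
          by (simp add: algebra_simps flip: exp_add)
        show ?thesis
          using True A C q_nonneg[of "x - \<mu>"]
          unfolding 1 2 3 4 5
          by (simp add: mult_ac flip: ennreal_mult)
      qed simp
    qed
    also have "\<dots> = ennreal (A * C * q (x - \<mu>)) * ?I (p + \<beta> * Q (x - \<mu>))"
      by (rule nn_integral_cmult) simp
    finally show ?thesis .
  qed
  have [measurable]: "h \<in> borel_measurable lborel"
    using T by (simp add: distributed_def)
  have "(\<integral>\<^sup>+ x. h x \<partial>lborel) = (\<integral>\<^sup>+ \<omega>. 1 \<partial>M)"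
    using distributed_nn_integral[OF T, of "\<lambda>_. 1"] by simp
  then have "AE x in lborel. h x \<noteq> \<infinity>"
    by (intro nn_integral_PInf_AE) (simp_all add: emeasure_space_1)
  then show pos: "AE x in lborel. q (x - \<mu>) \<noteq> 0 \<longrightarrow> b > 0 \<and> p + \<beta> * Q (x - \<mu>) > 0"
  proof eventually_elim
    case (elim x)
    show ?case
    proof (rule impI, rule ccontr)
      assume "q (x - \<mu>) \<noteq> 0" and "\<not> (b > 0 \<and> p + \<beta> * Q (x - \<mu>) > 0)"
      \<comment> \<open>Strict positivity of the prefactor matters: in \<open>ennreal\<close> a zero
        factor would absorb the infinite integral.\<close>
      then have "b \<le> 0 \<or> p + \<beta> * Q (x - \<mu>) \<le> 0" and "A * C * q (x - \<mu>) > 0"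
        using A C q_nonneg[of "x - \<mu>"] by (auto simp: less_le)
      moreover from this(1) have "?I (p + \<beta> * Q (x - \<mu>)) = \<infinity>"
        by (rule nn_integral_Gamma_scaled_diverges)
      ultimately show False
        using elim by (auto simp: h ennreal_mult_top split: if_splits)
    qed
  qed
  have "AE x in lborel. h x = ennreal (A * C * Gamma b * (p + \<beta> * Q (x - \<mu>)) powr - b * q (x - \<mu>))"
    using pos
  proof eventually_elim
    case (elim x)
    show ?case
    \<comment> \<open>Where \<open>q\<close> vanishes, \<open>h x\<close> is 0 even if the inner
      integral is infinite, and so is the closed formula.\<close>
    proof (cases "q (x - \<mu>) = 0")
      case False
      then have "b > 0" "p + \<beta> * Q (x - \<mu>) > 0" using elim by auto
      then have "h x = ennreal (A * C * q (x - \<mu>)) * ennreal (Gamma b * (p + \<beta> * Q (x - \<mu>)) powr - b)"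
        by (simp only: h nn_integral_Gamma_scaled)
      then show ?thesis
        using A C q_nonneg[of "x - \<mu>"] by (simp add: mult_ac flip: ennreal_mult')
    qed (simp add: h)
  qed
  then show "distributed M lborel ?T
      (\<lambda>x. ennreal (A * C * Gamma b * (p + \<beta> * Q (x - \<mu>)) powr - b * q (x - \<mu>)))"
    using T by (subst (asm) distributed_cong_density) simp_all
qed


theorem theorem3p2:
  fixes M :: "'w measure"
    and S :: "'w \<Rightarrow> real"
    and Y :: "'w \<Rightarrow> ('a::normed_division_algebra, 'n::finite, 'm::{finite,linorder}) mtx"
    and \<mu> :: "('a, 'n, 'm) mtx" and \<Theta> :: "('a, 'n, 'n) mtx" and \<Sigma> :: "('a, 'm, 'm) mtx"
    and \<beta> \<rho> k :: real and \<nu> c :: complex and t :: "nat \<Rightarrow> real" and m n :: nat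
  assumes "\<beta> = real DIM('a)" and "m = CARD('m)" and "n = CARD('n)"
    and "n \<ge> m" and "m \<ge> 1"
    and "\<rho> > 0"
    and "Re (\<nu> * \<beta> / 2) > k"
    and "n * \<beta> / 2 > (real m - 1) * \<beta> / 2 + t 1"
    and "\<Sigma> \<in> pos_def_cone" and "\<Theta> \<in> pos_def_cone" and "\<mu> \<in> distinct_sv_matrices"
    and "prob_space M"
    and "riesz_II M S \<beta> (\<nu> * \<beta> / 2) k \<rho>"
    and "kotz_riesz_II M Y t 0 \<Theta> \<Sigma>"
    and "indep_rvs M S Y"
    and "c = of_real (mv_Gamma \<beta> m (n * \<beta> / 2)) *
             mv_Gamma \<beta> 1 ((\<nu> + of_nat (m * n)) * \<beta> / 2 - k - (\<Sum>i = 1..m. t i)) *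
             of_real (\<rho> powr (\<beta> * m * n / 2 - (\<Sum>i = 1..m. t i))) /
             (of_real (pi powr (\<beta> * m * n / 2)) *
              of_real (mv_Gamma_neg \<beta> m (n * \<beta> / 2) t) *
              mv_Gamma \<beta> 1 (\<nu> * \<beta> / 2 - k) *
              of_real (hdet \<Sigma> powr (\<beta> * n / 2)) *
              of_real (hdet \<Theta> powr (\<beta> * m / 2)))"
  shows "has_density M (\<lambda>\<omega>. (1 / sqrt (S \<omega>)) *\<^sub>R Y \<omega> + \<mu>)
    (\<lambda>T. c *
      of_real (1 + \<rho> * re_trace (minv \<Sigma> \<star> mmul3 (ctrans (T - \<mu>)) (minv \<Theta>) (T - \<mu>)))
        powr (- ((\<nu> + of_nat (m * n)) * \<beta> / 2 - k - (\<Sum>i = 1..m. t i))) *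
      of_real (q_factor t \<Theta> \<Sigma> (T - \<mu>)))"
proof -
  interpret prob_space M by fact
  let ?q = "q_factor t \<Theta> \<Sigma>" and ?Q = "quad_form \<Theta> \<Sigma>"
  define \<tau> where "\<tau> = (\<Sum>i = 1..m. t i)"
  define a where "a = Re (\<nu> * \<beta> / 2) - k"
  define d where "d = \<beta> * m * n"
  define b where "b = a + d / 2 - \<tau>"
  define z where "z = \<nu> * complex_of_real \<beta> / 2 - of_real k"
  have \<beta>: "\<beta> > 0" using assms(1) by simp
  have \<rho>: "\<rho> > 0" by fact
  have d: "d = DIM(('a, 'n, 'm) mtx)" using assms(1-3) by (simp add: d_def mult_ac)
  have a: "a > 0" using assms(7) by (simp add: a_def)

  \<comment> \<open>The law of S and the reality of its parameter\<close>
  have Sz: "has_density M S (\<lambda>s. if s > 0 then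
        of_real \<beta> powr z / (Gamma z * of_real \<rho> powr z) *
        of_real (exp (- \<beta> * s / \<rho>)) * of_real s powr (z - 1) else 0)"
    using assms(13) unfolding riesz_II_def z_def .
  define K where "K = of_real \<beta> powr z / (Gamma z * of_real \<rho> powr z)"
  have z: "z = of_real a"
  proof -
    have Re_z: "Re z = a" by (simp add: z_def a_def)
    \<comment> \<open>At a pole \<open>Gamma\<close> has the value 0 and \<open>K\<close> would be
      0; the positive real part of \<open>z\<close> excludes this.\<close>
    then have "z \<notin> \<int>\<^sub>\<le>\<^sub>0"
      using a by (auto elim!: nonpos_Ints_cases)
    then have K0: "K \<noteq> 0"
      using \<beta> \<rho> by (simp add: K_def Gamma_eq_zero_iff)
    have "AE s in lborel. s > 0 \<longrightarrow> K * of_real s powr (z - 1) \<in> \<real>\<^sub>\<ge>\<^sub>0"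
    proof -
      have "AE s in lborel. s > 0 \<longrightarrow>
          K * of_real (exp (- \<beta> * s / \<rho>)) * of_real s powr (z - 1) \<in> \<real>\<^sub>\<ge>\<^sub>0"
        using Sz unfolding has_density_def K_def by (auto elim!: eventually_mono)
      then show ?thesis
      proof eventually_elim
        case (elim s)
        \<comment> \<open>Multiplication by a positive real removes the exponential factor and
          leaves a pure power.\<close>
        have "K * of_real s powr (z - 1) = of_real (exp (\<beta> * s / \<rho>)) *
            (K * of_real (exp (- \<beta> * s / \<rho>)) * of_real s powr (z - 1))"
          by (simp add: exp_minus field_simps)
        also have "\<dots> \<in> \<real>\<^sub>\<ge>\<^sub>0" if "s > 0"
          by (rule nonneg_Reals_mult_I[OF _ elim[rule_format, OF that]]) simp
        finally show ?case by blast
      qed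
    qed
    then have "Im (z - 1) = 0" using K0 by (rule exponent_real_if_AE_nonneg)
    then show ?thesis by (simp add: complex_eq_iff z_def a_def)
  qed

  define A where "A = \<beta> powr a / (Gamma a * \<rho> powr a)"
  have A: "A > 0" using \<beta> \<rho> a by (simp add: A_def Gamma_real_pos)
  have S: "distributed M lborel S (\<lambda>s. ennreal (if s > 0 then A * s powr (a - 1) * exp (- (\<beta> / \<rho>) * s) else 0))"
  proof -
    have "Re (if s > 0 then of_real \<beta> powr z / (Gamma z * of_real \<rho> powr z) *
        of_real (exp (- \<beta> * s / \<rho>)) * of_real s powr (z - 1) else 0) =
        (if s > 0 then A * s powr (a - 1) * exp (- (\<beta> / \<rho>) * s) else 0)" for s :: real
    proof (cases "s > 0")
      case True
      have "z - 1 = of_real (a - 1)" by (simp add: z)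
      moreover have "of_real \<beta> powr z / (Gamma z * of_real \<rho> powr z) = of_real A"
        using \<beta> \<rho> by (simp add: z A_def powr_of_real Gamma_complex_of_real)
      ultimately show ?thesis using True
        by (simp add: powr_of_real del: of_real_diff)
    qed simp
    then show ?thesis using Sz unfolding has_density_def by simp
  qed

  \<comment> \<open>The law of Y: sign of its constant and measurability of its factors\<close>
  define D where "D = pi powr (d / 2) * mv_Gamma_neg \<beta> m (n * \<beta> / 2) t *
    hdet \<Sigma> powr (\<beta> * n / 2) * hdet \<Theta> powr (\<beta> * m / 2)"
  define C where "C = \<beta> powr (d / 2 - \<tau>) * mv_Gamma \<beta> m (n * \<beta> / 2) / D"
  have Y: "distributed M lborel Y (\<lambda>X. ennreal (C * exp (- \<beta> * ?Q X) * ?q X))"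
    using assms(14) unfolding kotz_riesz_II_def has_density_def assms(1)[symmetric] assms(2)[symmetric]
      assms(3)[symmetric] Let_def
    by (simp add: etr_def re_trace_scaleR re_trace_minus C_def D_def d_def \<tau>_def quad_form_def mult_ac)
  \<comment> \<open>The sign is read off the total mass rather than from the gamma factors and
    determinants: with \<open>C\<close> nonpositive, the density of \<open>Y\<close> would be 0
    everywhere.\<close>
  have C: "C > 0"
  proof (rule ccontr)
    assume "\<not> C > 0"
    then have "ennreal (C * exp (- \<beta> * ?Q X) * ?q X) = 0" for X
      by (intro ennreal_neg mult_nonpos_nonneg q_factor_nonneg) auto
    then have "(\<integral>\<^sup>+ \<omega>. 1 \<partial>M) = 0"
      using distributed_nn_integral[OF Y, of "\<lambda>_. 1"] by simp
    then show False by (simp add: emeasure_space_1)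
  qed
  have Q_meas [measurable]: "?Q \<in> borel_measurable borel"
    by (rule borel_measurable_continuous_onI continuous_on_quad_form)+
  \<comment> \<open>Measurability is recovered from the density of \<open>Y\<close>, by dividing it
    by its positive continuous factor.\<close>
  have q_meas [measurable]: "?q \<in> borel_measurable borel"
  proof -
    have [measurable]: "(\<lambda>X. ennreal (C * exp (- \<beta> * ?Q X) * ?q X)) \<in> borel_measurable borel"
      using Y by (simp add: distributed_def)
    have "?q = (\<lambda>X. enn2real (ennreal (C * exp (- \<beta> * ?Q X) * ?q X)) / (C * exp (- \<beta> * ?Q X)))"
      using C by (simp add: fun_eq_iff q_factor_nonneg)
    also have "\<dots> \<in> borel_measurable borel" by measurable
    finally show ?thesis .
  qed

  \<comment> \<open>The premise left open is the homogeneity of the generalised power factor,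
    supplied by the fact \<open>q\<close> below.\<close>
  note hom = distributed_scale_mixture_homogeneous[where q = ?q and Q = ?Q and p = "\<beta> / \<rho>" and \<tau> = \<tau>
      and \<mu> = \<mu>, OF S Y assms(15) A C q_factor_nonneg _ quad_form_scaleR q_meas Q_meas]
  have q: "?q (r *\<^sub>R X) = r powr (- 2 * \<tau>) * ?q X" if "r > 0" for r X
    using q_factor_scaleR[OF that, of t \<Theta> \<Sigma> X] by (simp add: \<tau>_def assms(2))
  have pos: "AE X in lborel. ?q (X - \<mu>) \<noteq> 0 \<longrightarrow> b > 0 \<and> \<beta> / \<rho> + \<beta> * ?Q (X - \<mu>) > 0"
    and T: "distributed M lborel (\<lambda>\<omega>. (1 / sqrt (S \<omega>)) *\<^sub>R Y \<omega> + \<mu>)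
      (\<lambda>X. ennreal (A * C * Gamma b * (\<beta> / \<rho> + \<beta> * ?Q (X - \<mu>)) powr - b * ?q (X - \<mu>)))"
    using hom q unfolding b_def d by blast+

  \<comment> \<open>Identification of the exponent and of the constant\<close>
  define cr where "cr = mv_Gamma \<beta> m (n * \<beta> / 2) * Gamma b * \<rho> powr (d / 2 - \<tau>) / (D * Gamma a)"
  have zb: "(\<nu> + of_nat (m * n)) * \<beta> / 2 - k - (\<Sum>i = 1..m. t i) = complex_of_real b"
  proof -
    have "(\<nu> + of_nat (m * n)) * \<beta> / 2 - k - (\<Sum>i = 1..m. t i) = z + of_real (d / 2 - \<tau>)"
      by (simp add: z_def d_def \<tau>_def field_simps)
    then show ?thesis by (simp add: z b_def)
  qed
  \<comment> \<open>In size 1 the power of pi in \<open>mv_Gamma\<close> has exponent 0, leaving the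
    ordinary gamma function.\<close>
  have c: "c = of_real cr"
    unfolding assms(16) zb z_def[symmetric] z
    by (simp add: mv_Gamma_def Gamma_complex_of_real cr_def D_def d_def \<tau>_def mult_ac)
  let ?F = "\<lambda>X. c * of_real (1 + \<rho> * ?Q (X - \<mu>)) powr (- of_real b) * of_real (?q (X - \<mu>))"
  have F: "?F X = of_real (A * C * Gamma b * (\<beta> / \<rho> + \<beta> * ?Q (X - \<mu>)) powr - b * ?q (X - \<mu>))
      \<and> A * C * Gamma b * (\<beta> / \<rho> + \<beta> * ?Q (X - \<mu>)) powr - b * ?q (X - \<mu>) \<ge> 0"
    if "?q (X - \<mu>) \<noteq> 0 \<longrightarrow> b > 0 \<and> \<beta> / \<rho> + \<beta> * ?Q (X - \<mu>) > 0" for X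
  proof (cases "?q (X - \<mu>) = 0")
    case False
    then have b: "b > 0" and pos: "\<beta> / \<rho> + \<beta> * ?Q (X - \<mu>) > 0" using that by auto
    have eq: "\<beta> / \<rho> + \<beta> * ?Q (X - \<mu>) = \<beta> / \<rho> * (1 + \<rho> * ?Q (X - \<mu>))"
      using \<rho> by (simp add: field_simps)
    have pos': "1 + \<rho> * ?Q (X - \<mu>) > 0"
      using pos \<beta> \<rho> unfolding eq by (simp add: zero_less_mult_iff zero_less_divide_iff)
    \<comment> \<open>Factoring \<beta> / \<rho> out of the rate cancels all powers of \<beta>,
      since \<open>A\<close> and \<open>C\<close> together carry \<open>\<beta> powr b\<close>; of
      \<rho> there remains the exponent b - a = d / 2 - \<tau>.\<close>
    have "A * C * Gamma b * (\<beta> / \<rho>) powr - b = cr"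
    proof -
      have "(\<beta> / \<rho>) powr - b = \<rho> powr b / \<beta> powr b"
        using \<beta> \<rho> by (simp add: powr_minus powr_divide field_simps)
      moreover have "\<rho> powr b = \<rho> powr a * \<rho> powr (d / 2 - \<tau>)" "\<beta> powr b = \<beta> powr a * \<beta> powr (d / 2 - \<tau>)"
        by (simp_all add: b_def flip: powr_add) (simp_all add: algebra_simps)
      ultimately show ?thesis
        using \<beta> \<rho> by (simp add: A_def C_def cr_def mult_ac)
    qed
    then have "A * C * Gamma b * (\<beta> / \<rho> + \<beta> * ?Q (X - \<mu>)) powr - b = cr * (1 + \<rho> * ?Q (X - \<mu>)) powr - b"
      unfolding eq powr_mult by (simp flip: mult.assoc)
    moreover have "of_real (1 + \<rho> * ?Q (X - \<mu>)) powr (- of_real b) =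
        complex_of_real ((1 + \<rho> * ?Q (X - \<mu>)) powr - b)"
      using pos' powr_of_real[of "1 + \<rho> * ?Q (X - \<mu>)" "- b"] by simp
    moreover have "A * C * Gamma b * (\<beta> / \<rho> + \<beta> * ?Q (X - \<mu>)) powr - b * ?q (X - \<mu>) \<ge> 0"
      using A C b by (intro mult_nonneg_nonneg q_factor_nonneg) (auto intro: less_imp_le Gamma_real_pos)
    ultimately show ?thesis by (simp add: c)
  qed simp

  \<comment> \<open>Passage to the complex-valued formula\<close>
  have "has_density M (\<lambda>\<omega>. (1 / sqrt (S \<omega>)) *\<^sub>R Y \<omega> + \<mu>) ?F"
    unfolding has_density_def
  proof
    show "AE X in lborel. ?F X \<in> \<real>\<^sub>\<ge>\<^sub>0"
      using pos
    proof eventually_elim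
      case (elim X)
      show ?case by (simp only: F[OF elim] nonneg_Reals_of_real_iff)
    qed
    \<comment> \<open>The principal branch is discontinuous across the negative axis, so the power
      is split by the sign of its base; measurability is required on the whole line.\<close>
    have powr_meas [measurable]: "(\<lambda>y. complex_of_real y powr (- of_real b)) \<in> borel_measurable borel"
    proof -
      have "(\<lambda>y. complex_of_real y powr (- of_real b)) =
          (\<lambda>y. if y < 0 then of_real (\<bar>y\<bar> powr - b) * exp (\<i> * pi * of_real (- b)) else of_real (y powr - b))"
        using powr_of_real_if[of _ "- b"] by (simp add: fun_eq_iff)
      also have "\<dots> \<in> borel_measurable borel" by measurable
      finally show ?thesis .
    qed
    have "?F \<in> borel_measurable borel"
      by (intro borel_measurable_times borel_measurable_const measurable_compose[OF _ powr_meas]) measurable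
    then have F_meas: "(\<lambda>X. ennreal (Re (?F X))) \<in> borel_measurable lborel"
      by (intro measurable_compose[OF _ measurable_ennreal] measurable_compose[OF _ borel_measurable_Re]) simp
    \<comment> \<open>The two formulas are known to agree only where \<open>pos\<close> holds, hence
      outside a null set; this suffices for a density.\<close>
    have ae: "AE X in lborel. ennreal (A * C * Gamma b * (\<beta> / \<rho> + \<beta> * ?Q (X - \<mu>)) powr - b * ?q (X - \<mu>)) =
        ennreal (Re (?F X))"
      using pos
    proof eventually_elim
      case (elim X)
      show ?case by (simp only: F[OF elim] Re_complex_of_real)
    qed
    show "distributed M lborel (\<lambda>\<omega>. (1 / sqrt (S \<omega>)) *\<^sub>R Y \<omega> + \<mu>) (\<lambda>X. ennreal (Re (?F X)))"
      using T by (intro distributed_cong_density[THEN iffD1, OF ae F_meas _ T]) (simp add: distributed_def)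
  qed
  then show ?thesis unfolding zb quad_form_def .
qed

end
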